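(* Let $p$ be a prime number, let $G$ be a group of order $p^{m}$, and let $[c]\in H^2(G,\mathbb{C}^* )$ be any cohomology class. Then for every non-negative integer $i$ such that $$\frac{i^2+i-2}{2}<m,$$ there is a normal abelian subgroup $A\lhd G$ of order $p^i$ which is isotropic with respect to $[c]$.
   Context: $\mathbb{C}^*$ is regarded as a trivial $G$-module, and $H^2(G,\mathbb{C}^* )$ is the second cohomology group. A subgroup $H$ of $G$ is isotropic with respect to $[c]\in H^2(G,\mathbb{C}^* )$ if $\mathrm{res}^G_H[c]=0$ in $H^2(H,\mathbb{C}^* )$. *)

theory Defs
  imports Complex_Main "HOL-Computational_Algebra.Primes" "HOL-Algebra.Algebra"
begin

text \<open>
  The second cohomology group $H^2(G,M)$ of a group $G$ with coefficients in an abelian group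
  $M$ (written multiplicatively) carrying the trivial $G$-action, by the inhomogeneous
  (bar resolution) complex.  Cochains are not required to be normalised.  As functions they are
  extensional, so that two cochains are equal as soon as they agree on the carrier of $G$.
\<close>

abbreviation cochains1 ::
  "('a, 'x) monoid_scheme \<Rightarrow> ('b, 'y) monoid_scheme \<Rightarrow> ('a \<Rightarrow> 'b) monoid"
  where "cochains1 G M \<equiv> product_group (carrier G) (\<lambda>_. M)"

abbreviation cochains2 ::
  "('a, 'x) monoid_scheme \<Rightarrow> ('b, 'y) monoid_scheme \<Rightarrow> ('a \<times> 'a \<Rightarrow> 'b) monoid"
  where "cochains2 G M \<equiv> product_group (carrier G \<times> carrier G) (\<lambda>_. M)"

definition cocycles2 ::
  "('a, 'x) monoid_scheme \<Rightarrow> ('b, 'y) monoid_scheme \<Rightarrow> ('a \<times> 'a \<Rightarrow> 'b) set"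
  where "cocycles2 G M =
    {c \<in> carrier (cochains2 G M).
       \<forall>g\<in>carrier G. \<forall>h\<in>carrier G. \<forall>k\<in>carrier G.
         c (h, k) \<otimes>\<^bsub>M\<^esub> c (g, h \<otimes>\<^bsub>G\<^esub> k) = c (g \<otimes>\<^bsub>G\<^esub> h, k) \<otimes>\<^bsub>M\<^esub> c (g, h)}"

definition coboundary1 ::
  "('a, 'x) monoid_scheme \<Rightarrow> ('b, 'y) monoid_scheme \<Rightarrow> ('a \<Rightarrow> 'b) \<Rightarrow> 'a \<times> 'a \<Rightarrow> 'b"
  where "coboundary1 G M b =
    (\<lambda>(g, h)\<in>carrier G \<times> carrier G. b h \<otimes>\<^bsub>M\<^esub> inv\<^bsub>M\<^esub> (b (g \<otimes>\<^bsub>G\<^esub> h)) \<otimes>\<^bsub>M\<^esub> b g)"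

definition coboundaries2 ::
  "('a, 'x) monoid_scheme \<Rightarrow> ('b, 'y) monoid_scheme \<Rightarrow> ('a \<times> 'a \<Rightarrow> 'b) set"
  where "coboundaries2 G M = coboundary1 G M ` carrier (cochains1 G M)"

abbreviation cocycle2_group ::
  "('a, 'x) monoid_scheme \<Rightarrow> ('b, 'y) monoid_scheme \<Rightarrow> ('a \<times> 'a \<Rightarrow> 'b) monoid"
  where "cocycle2_group G M \<equiv> (cochains2 G M)\<lparr>carrier := cocycles2 G M\<rparr>"

definition H2 ::
  "('a, 'x) monoid_scheme \<Rightarrow> ('b, 'y) monoid_scheme \<Rightarrow> ('a \<times> 'a \<Rightarrow> 'b) set monoid"
  where "H2 G M = cocycle2_group G M Mod coboundaries2 G M"

definition cohomology_class2 ::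
  "('a, 'x) monoid_scheme \<Rightarrow> ('b, 'y) monoid_scheme \<Rightarrow> ('a \<times> 'a \<Rightarrow> 'b) \<Rightarrow> ('a \<times> 'a \<Rightarrow> 'b) set"
  where "cohomology_class2 G M c = r_coset (cocycle2_group G M) (coboundaries2 G M) c"

text \<open>
  Restriction of classes to the subgroup with carrier \<open>H\<close>.  All representatives of a class
  restrict to the same class on the subgroup, so \<open>the_elem\<close> is applied to a singleton;
  see \<open>res2_class\<close> below.
\<close>

definition res2 ::
  "('a, 'x) monoid_scheme \<Rightarrow> 'a set \<Rightarrow> ('b, 'y) monoid_scheme
    \<Rightarrow> ('a \<times> 'a \<Rightarrow> 'b) set \<Rightarrow> ('a \<times> 'a \<Rightarrow> 'b) set"
  where "res2 G H M \<xi> =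
    the_elem ((\<lambda>c. cohomology_class2 (G\<lparr>carrier := H\<rparr>) M (restrict c (H \<times> H))) ` \<xi>)"

definition Cstar :: "complex monoid"
  where "Cstar = \<lparr>carrier = {z. z \<noteq> 0}, monoid.mult = (*), one = 1\<rparr>"

definition isotropic ::
  "('a, 'x) monoid_scheme \<Rightarrow> 'a set \<Rightarrow> ('a \<times> 'a \<Rightarrow> complex) set \<Rightarrow> bool"
  where "isotropic G H \<kappa> \<longleftrightarrow>
    subgroup H G \<and> res2 G H Cstar \<kappa> = \<one>\<^bsub>H2 (G\<lparr>carrier := H\<rparr>) Cstar\<^esub>"


lemma comm_group_Cstar: "comm_group Cstar"
proof (rule comm_groupI)
  fix x assume "x \<in> carrier Cstar"
  then show "\<exists>y\<in>carrier Cstar. y \<otimes>\<^bsub>Cstar\<^esub> x = \<one>\<^bsub>Cstar\<^esub>"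
    by (intro bexI[of _ "inverse x"]) (auto simp: Cstar_def)
qed (auto simp: Cstar_def)

lemma comm_group_product_group:
  assumes "comm_group M" shows "comm_group (product_group I (\<lambda>_. M))"
proof -
  interpret M: comm_group M by fact
  interpret P: group "product_group I (\<lambda>_. M)" by (rule product_group) (rule M.group_axioms)
  show ?thesis
    by (rule P.group_comm_groupI) (auto simp: PiE_iff M.m_comm fun_eq_iff)
qed

lemma hom_coboundary1:
  assumes "group G" "comm_group M"
  shows "coboundary1 G M \<in> hom (cochains1 G M) (cochains2 G M)"
proof -
  interpret G: group G by fact
  interpret M: comm_group M by fact
  show ?thesis
    by (rule homI)
       (auto simp: coboundary1_def PiE_iff fun_eq_iff M.inv_mult M.m_ac)
qed

lemma coboundaries2_subset_cocycles2:
  assumes "group G" "comm_group M"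
  shows "coboundaries2 G M \<subseteq> cocycles2 G M"
proof -
  interpret G: group G by fact
  interpret M: comm_group M by fact
  have "coboundary1 G M b \<in> cocycles2 G M" if b: "b \<in> carrier (cochains1 G M)" for b
  proof -
    have [simp]: "b g \<in> carrier M" if "g \<in> carrier G" for g
      using b that by (auto simp: PiE_iff)
    have "coboundary1 G M b \<in> carrier (cochains2 G M)"
      using hom_coboundary1[OF assms] b unfolding hom_def by blast
    moreover have "coboundary1 G M b (h, k) \<otimes>\<^bsub>M\<^esub> coboundary1 G M b (g, h \<otimes>\<^bsub>G\<^esub> k)
        = coboundary1 G M b (g \<otimes>\<^bsub>G\<^esub> h, k) \<otimes>\<^bsub>M\<^esub> coboundary1 G M b (g, h)"
      if "g \<in> carrier G" "h \<in> carrier G" "k \<in> carrier G" for g h k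
    proof -
      have cancel: "(u \<otimes>\<^bsub>M\<^esub> inv\<^bsub>M\<^esub> x \<otimes>\<^bsub>M\<^esub> v) \<otimes>\<^bsub>M\<^esub> (x \<otimes>\<^bsub>M\<^esub> y \<otimes>\<^bsub>M\<^esub> w) =
          (u \<otimes>\<^bsub>M\<^esub> y \<otimes>\<^bsub>M\<^esub> x') \<otimes>\<^bsub>M\<^esub> (v \<otimes>\<^bsub>M\<^esub> inv\<^bsub>M\<^esub> x' \<otimes>\<^bsub>M\<^esub> w)"
        if "x \<in> carrier M" "x' \<in> carrier M" "y \<in> carrier M"
          "u \<in> carrier M" "v \<in> carrier M" "w \<in> carrier M" for x x' y u v w
      proof -
        have l: "(u \<otimes>\<^bsub>M\<^esub> z \<otimes>\<^bsub>M\<^esub> v) \<otimes>\<^bsub>M\<^esub> (x \<otimes>\<^bsub>M\<^esub> y \<otimes>\<^bsub>M\<^esub> w)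
            = (x \<otimes>\<^bsub>M\<^esub> z) \<otimes>\<^bsub>M\<^esub> (u \<otimes>\<^bsub>M\<^esub> y \<otimes>\<^bsub>M\<^esub> v \<otimes>\<^bsub>M\<^esub> w)"
          if "z \<in> carrier M" for z
          using that \<open>x \<in> carrier M\<close> \<open>y \<in> carrier M\<close>
            \<open>u \<in> carrier M\<close> \<open>v \<in> carrier M\<close> \<open>w \<in> carrier M\<close> by (simp add: M.m_ac)
        have r: "(u \<otimes>\<^bsub>M\<^esub> y \<otimes>\<^bsub>M\<^esub> x') \<otimes>\<^bsub>M\<^esub> (v \<otimes>\<^bsub>M\<^esub> z \<otimes>\<^bsub>M\<^esub> w)
            = (x' \<otimes>\<^bsub>M\<^esub> z) \<otimes>\<^bsub>M\<^esub> (u \<otimes>\<^bsub>M\<^esub> y \<otimes>\<^bsub>M\<^esub> v \<otimes>\<^bsub>M\<^esub> w)"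
          if "z \<in> carrier M" for z
          using that \<open>x' \<in> carrier M\<close> \<open>y \<in> carrier M\<close>
            \<open>u \<in> carrier M\<close> \<open>v \<in> carrier M\<close> \<open>w \<in> carrier M\<close> by (simp add: M.m_ac)
        show ?thesis
          unfolding l[OF M.inv_closed[OF that(1)]] r[OF M.inv_closed[OF that(2)]]
          using that(1,2) by (simp only: M.r_inv)
      qed
      have "b k \<otimes>\<^bsub>M\<^esub> inv\<^bsub>M\<^esub> b (h \<otimes>\<^bsub>G\<^esub> k) \<otimes>\<^bsub>M\<^esub> b h \<otimes>\<^bsub>M\<^esub>
            (b (h \<otimes>\<^bsub>G\<^esub> k) \<otimes>\<^bsub>M\<^esub> inv\<^bsub>M\<^esub> b (g \<otimes>\<^bsub>G\<^esub> (h \<otimes>\<^bsub>G\<^esub> k)) \<otimes>\<^bsub>M\<^esub> b g) =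
          b k \<otimes>\<^bsub>M\<^esub> inv\<^bsub>M\<^esub> b (g \<otimes>\<^bsub>G\<^esub> (h \<otimes>\<^bsub>G\<^esub> k)) \<otimes>\<^bsub>M\<^esub> b (g \<otimes>\<^bsub>G\<^esub> h) \<otimes>\<^bsub>M\<^esub>
            (b h \<otimes>\<^bsub>M\<^esub> inv\<^bsub>M\<^esub> b (g \<otimes>\<^bsub>G\<^esub> h) \<otimes>\<^bsub>M\<^esub> b g)"
        using that by (intro cancel) auto
      then show ?thesis
        using that by (simp add: coboundary1_def G.m_assoc)
    qed
    ultimately show ?thesis by (simp add: cocycles2_def)
  qed
  then show ?thesis by (auto simp: coboundaries2_def)
qed

lemma subgroup_cocycles2:
  assumes "group G" "comm_group M"
  shows "subgroup (cocycles2 G M) (cochains2 G M)"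
proof -
  interpret G: group G by fact
  interpret M: comm_group M by fact
  interpret C: comm_group "cochains2 G M" by (rule comm_group_product_group) fact
  show ?thesis
  proof (rule C.subgroupI)
    show "cocycles2 G M \<subseteq> carrier (cochains2 G M)" by (auto simp: cocycles2_def)
    show "cocycles2 G M \<noteq> {}"
    proof -
      have "(\<lambda>_\<in>carrier G. \<one>\<^bsub>M\<^esub>) \<in> carrier (cochains1 G M)" by simp
      then show ?thesis
        using coboundaries2_subset_cocycles2[OF assms] unfolding coboundaries2_def by blast
    qed
  next
    fix a assume a: "a \<in> cocycles2 G M"
    then have [simp]: "a (g, h) \<in> carrier M" if "g \<in> carrier G" "h \<in> carrier G" for g h
      using that by (auto simp: cocycles2_def PiE_iff)
    have a_in: "a \<in> carrier (cochains2 G M)" using a by (simp add: cocycles2_def)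
    have "inv\<^bsub>cochains2 G M\<^esub> a = (\<lambda>x\<in>carrier G \<times> carrier G. inv\<^bsub>M\<^esub> a x)"
      using a_in by (intro inv_product_group) auto
    then show "inv\<^bsub>cochains2 G M\<^esub> a \<in> cocycles2 G M"
      using a by (auto simp: cocycles2_def M.inv_mult[symmetric] PiE_iff)
  next
    fix a b assume a: "a \<in> cocycles2 G M" and b: "b \<in> cocycles2 G M"
    then have [simp]: "a (g, h) \<in> carrier M" "b (g, h) \<in> carrier M"
      if "g \<in> carrier G" "h \<in> carrier G" for g h
      using that by (auto simp: cocycles2_def PiE_iff)
    have "(a (h, k) \<otimes>\<^bsub>M\<^esub> b (h, k)) \<otimes>\<^bsub>M\<^esub> (a (g, h \<otimes>\<^bsub>G\<^esub> k) \<otimes>\<^bsub>M\<^esub> b (g, h \<otimes>\<^bsub>G\<^esub> k))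
      = (a (g \<otimes>\<^bsub>G\<^esub> h, k) \<otimes>\<^bsub>M\<^esub> b (g \<otimes>\<^bsub>G\<^esub> h, k)) \<otimes>\<^bsub>M\<^esub> (a (g, h) \<otimes>\<^bsub>M\<^esub> b (g, h))"
      if "g \<in> carrier G" "h \<in> carrier G" "k \<in> carrier G" for g h k
    proof -
      have swap: "(x \<otimes>\<^bsub>M\<^esub> y) \<otimes>\<^bsub>M\<^esub> (z \<otimes>\<^bsub>M\<^esub> w) = (x \<otimes>\<^bsub>M\<^esub> z) \<otimes>\<^bsub>M\<^esub> (y \<otimes>\<^bsub>M\<^esub> w)"
        if "x \<in> carrier M" "y \<in> carrier M" "z \<in> carrier M" "w \<in> carrier M" for x y z w
        using that by (simp add: M.m_ac)
      have ab: "a (h, k) \<otimes>\<^bsub>M\<^esub> a (g, h \<otimes>\<^bsub>G\<^esub> k) = a (g \<otimes>\<^bsub>G\<^esub> h, k) \<otimes>\<^bsub>M\<^esub> a (g, h)"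
        "b (h, k) \<otimes>\<^bsub>M\<^esub> b (g, h \<otimes>\<^bsub>G\<^esub> k) = b (g \<otimes>\<^bsub>G\<^esub> h, k) \<otimes>\<^bsub>M\<^esub> b (g, h)"
        using that a b by (auto simp: cocycles2_def)
      have "(a (h, k) \<otimes>\<^bsub>M\<^esub> b (h, k)) \<otimes>\<^bsub>M\<^esub> (a (g, h \<otimes>\<^bsub>G\<^esub> k) \<otimes>\<^bsub>M\<^esub> b (g, h \<otimes>\<^bsub>G\<^esub> k))
          = (a (h, k) \<otimes>\<^bsub>M\<^esub> a (g, h \<otimes>\<^bsub>G\<^esub> k)) \<otimes>\<^bsub>M\<^esub> (b (h, k) \<otimes>\<^bsub>M\<^esub> b (g, h \<otimes>\<^bsub>G\<^esub> k))"
        using that by (intro swap) auto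
      also have "\<dots> = (a (g \<otimes>\<^bsub>G\<^esub> h, k) \<otimes>\<^bsub>M\<^esub> a (g, h)) \<otimes>\<^bsub>M\<^esub> (b (g \<otimes>\<^bsub>G\<^esub> h, k) \<otimes>\<^bsub>M\<^esub> b (g, h))"
        unfolding ab ..
      also have "\<dots> = (a (g \<otimes>\<^bsub>G\<^esub> h, k) \<otimes>\<^bsub>M\<^esub> b (g \<otimes>\<^bsub>G\<^esub> h, k)) \<otimes>\<^bsub>M\<^esub> (a (g, h) \<otimes>\<^bsub>M\<^esub> b (g, h))"
        using that by (intro swap) auto
      finally show ?thesis .
    qed
    then show "a \<otimes>\<^bsub>cochains2 G M\<^esub> b \<in> cocycles2 G M"
      using a b by (auto simp: cocycles2_def PiE_iff)
  qed
qed

lemma cocycle2_group_mult: "monoid.mult (cocycle2_group G M) = monoid.mult (cochains2 G M)"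
  by simp

lemma comm_group_cocycle2_group:
  assumes "group G" "comm_group M" shows "comm_group (cocycle2_group G M)"
proof -
  interpret C: comm_group "cochains2 G M" by (rule comm_group_product_group) fact
  have grp: "group (cocycle2_group G M)"
    by (rule C.subgroup_imp_group) (rule subgroup_cocycles2[OF assms])
  show ?thesis
  proof (rule group.group_comm_groupI[OF grp])
    fix x y assume "x \<in> carrier (cocycle2_group G M)" "y \<in> carrier (cocycle2_group G M)"
    then have "x \<in> carrier (cochains2 G M)" "y \<in> carrier (cochains2 G M)"
      by (simp_all add: cocycles2_def)
    then have "x \<otimes>\<^bsub>cochains2 G M\<^esub> y = y \<otimes>\<^bsub>cochains2 G M\<^esub> x"
      by (rule C.m_comm)
    then show "x \<otimes>\<^bsub>cocycle2_group G M\<^esub> y = y \<otimes>\<^bsub>cocycle2_group G M\<^esub> x"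
      by (simp only: cocycle2_group_mult)
  qed
qed

lemma subgroup_coboundaries2:
  assumes "group G" "comm_group M"
  shows "subgroup (coboundaries2 G M) (cocycle2_group G M)"
proof -
  interpret C1: comm_group "cochains1 G M" by (rule comm_group_product_group) fact
  interpret C2: comm_group "cochains2 G M" by (rule comm_group_product_group) fact
  interpret d: group_hom "cochains1 G M" "cochains2 G M" "coboundary1 G M"
    by unfold_locales (rule hom_coboundary1[OF assms])
  have "subgroup (coboundaries2 G M) (cochains2 G M)"
    unfolding coboundaries2_def by (rule d.img_is_subgroup)
  then show ?thesis
    using C2.subgroup_incl subgroup_cocycles2[OF assms] coboundaries2_subset_cocycles2[OF assms]
    by blast
qed

lemma comm_group_H2:
  assumes "group G" "comm_group M" shows "comm_group (H2 G M)"
  unfolding H2_def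
  by (intro comm_group.abelian_FactGroup comm_group_cocycle2_group subgroup_coboundaries2 assms)

lemma carrier_H2: "carrier (H2 G M) = cohomology_class2 G M ` cocycles2 G M"
  by (auto simp: H2_def FactGroup_def RCOSETS_def cohomology_class2_def)

lemma restrict_cocycles2:
  assumes "subgroup H G" "c \<in> cocycles2 G M"
  shows "restrict c (H \<times> H) \<in> cocycles2 (G\<lparr>carrier := H\<rparr>) M"
proof -
  have "H \<subseteq> carrier G" by (rule subgroup.subset) fact
  then show ?thesis
    using assms(2) subgroup.m_closed[OF assms(1)]
    by (auto simp: cocycles2_def PiE_iff subset_iff)
qed

lemma restrict_coboundaries2:
  assumes "subgroup H G" "c \<in> coboundaries2 G M"
  shows "restrict c (H \<times> H) \<in> coboundaries2 (G\<lparr>carrier := H\<rparr>) M"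
proof -
  obtain b where b: "b \<in> carrier (cochains1 G M)" "c = coboundary1 G M b"
    using assms(2) by (auto simp: coboundaries2_def)
  have sub: "H \<subseteq> carrier G" by (rule subgroup.subset) fact
  have "restrict c (H \<times> H) = coboundary1 (G\<lparr>carrier := H\<rparr>) M (restrict b H)"
    using sub subgroup.m_closed[OF assms(1)]
    by (auto simp: b coboundary1_def fun_eq_iff restrict_def)
  moreover have "restrict b H \<in> carrier (cochains1 (G\<lparr>carrier := H\<rparr>) M)"
    using b sub by (auto simp: PiE_iff)
  ultimately show ?thesis by (auto simp: coboundaries2_def)
qed

lemma res2_class:
  assumes "group G" "comm_group M" "subgroup H G" "c \<in> cocycles2 G M"
  shows "res2 G H M (cohomology_class2 G M c) =
    cohomology_class2 (G\<lparr>carrier := H\<rparr>) M (restrict c (H \<times> H))"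
proof -
  let ?H = "G\<lparr>carrier := H\<rparr>"
  have H: "group ?H"
    using subgroup.subgroup_is_group[OF assms(3,1)] .
  have sub: "H \<subseteq> carrier G" using assms(3) by (rule subgroup.subset)
  interpret Z: comm_group "cocycle2_group G M"
    by (rule comm_group_cocycle2_group) fact+
  interpret ZH: comm_group "cocycle2_group ?H M"
    by (rule comm_group_cocycle2_group) fact+
  interpret BH: subgroup "coboundaries2 ?H M" "cocycle2_group ?H M"
    by (rule subgroup_coboundaries2) fact+
  have eq: "cohomology_class2 ?H M (restrict x (H \<times> H)) =
      cohomology_class2 ?H M (restrict c (H \<times> H))"
    if x: "x \<in> cohomology_class2 G M c" for x
  proof -
    obtain b where b: "b \<in> coboundaries2 G M" "x = b \<otimes>\<^bsub>cocycle2_group G M\<^esub> c"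
      using x unfolding cohomology_class2_def r_coset_def by blast
    have "restrict x (H \<times> H) =
        restrict b (H \<times> H) \<otimes>\<^bsub>cocycle2_group ?H M\<^esub> restrict c (H \<times> H)"
      using sub by (auto simp: b fun_eq_iff restrict_def)
    also have "\<dots> \<in> cohomology_class2 ?H M (restrict c (H \<times> H))"
      using restrict_coboundaries2[OF assms(3) b(1)]
      unfolding cohomology_class2_def r_coset_def by blast
    finally have "restrict x (H \<times> H) \<in> cohomology_class2 ?H M (restrict c (H \<times> H))" .
    moreover have "restrict c (H \<times> H) \<in> carrier (cocycle2_group ?H M)"
      using restrict_cocycles2[OF assms(3,4)] by simp
    ultimately show ?thesis
      using ZH.repr_independence[OF _ _ BH.subgroup_axioms]
      unfolding cohomology_class2_def by metis
  qed
  have "c \<in> cohomology_class2 G M c"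
    using Z.rcos_self[OF _ subgroup_coboundaries2[OF assms(1,2)]] assms(4)
    by (simp add: cohomology_class2_def)
  then show ?thesis
    unfolding res2_def by (intro the_elem_image_unique eq) blast+
qed

end

theory Submission
  imports Defs
begin

text \<open>
  A cocycle \<open>c\<close> representing the class defines a central extension
  \<open>1 \<rightarrow> \<complex>\<^sup>* \<rightarrow> E \<rightarrow> G \<rightarrow> 1\<close>, and the class restricts to zero on a subgroup \<open>A\<close> exactly
  when \<open>A\<close> lifts isomorphically to a subgroup \<open>S\<close> of \<open>E\<close>: the second coordinate of the lift is a
  cochain whose inverse bounds \<open>c\<close> on \<open>A\<close> (\<open>restrict_coboundary_of_lift\<close>).  So it suffices to
  find commutative subgroups \<open>S\<close> of \<open>E\<close>, mapped injectively onto normal subgroups of \<open>G\<close>, of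
  every order \<open>p ^ k\<close> with \<open>k (k + 1) / 2 \<le> m\<close>; for integers this is the bound on \<open>i\<close> in the
  theorem, since \<open>i (i + 1)\<close> is even.

  These are built by increasing the order by a factor \<open>p\<close> at a time.  Let \<open>A\<close> be the image of
  \<open>S\<close>, of order \<open>p ^ k\<close>, and let \<open>K\<close> be the image in \<open>G\<close> of the centralizer of \<open>S\<close> in \<open>E\<close>.  Then
  \<open>K\<close> is normal in \<open>G\<close> and contains \<open>A\<close>.  If \<open>K\<close> is strictly larger, then \<open>K / A\<close> meets the centre of
  the \<open>p\<close>-group \<open>G / A\<close>, so there is \<open>u \<in> K\<close> outside \<open>A\<close> that is central of order \<open>p\<close> modulo \<open>A\<close>.
  A lift \<open>y\<close> of \<open>u\<close> commutes with \<open>S\<close>; as complex numbers have \<open>p\<close>-th roots, it can be scaled so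
  that \<open>y ^ p \<in> S\<close>.  Then \<open>S\<close> and \<open>y\<close> generate the next subgroup (\<open>abelian_lift_extend\<close>).

  The construction continues as long as \<open>K\<close> is large, so the loss in each step has to be
  bounded.  For \<open>e\<close> in the centralizer of \<open>S\<close>, the commutator of \<open>e\<close> and \<open>y\<close> lies over \<open>A\<close> and
  its \<open>p\<close>-th power is trivial, because \<open>e\<close> commutes with \<open>y ^ p\<close>.  Over each element of \<open>A\<close> there are
  at most \<open>p\<close> such elements, one for each complex \<open>p\<close>-th root of unity, and two elements \<open>e\<close> with the same
  commutator differ by an element that commutes with \<open>y\<close>.  Hence the centralizer shrinks by at most a factor
  \<open>p ^ (k + 1)\<close> (\<open>card_image_centralizer_le\<close>).  After \<open>k\<close> steps the order of \<open>K\<close> is at least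
  \<open>p ^ (m - k (k + 1) / 2)\<close>, which exceeds \<open>p ^ k\<close> if \<open>(k + 1) (k + 2) / 2 \<le> m\<close>.
\<close>

section \<open>Central elements in \<open>p\<close>-groups\<close>

lemma prime_dvd_of_dvd_prime_power:
  fixes p d m :: nat
  assumes p: "Factorial_Ring.prime p" and d: "d dvd p ^ m" "d \<noteq> 1"
  shows "p dvd d"
proof -
  obtain k where k: "d = p ^ k" using p d(1) divides_primepow_nat by blast
  then have "k \<noteq> 0" using d(2) by (cases k) auto
  then show ?thesis using k by (simp add: dvd_power)
qed

text \<open>
  The conjugacy classes contained in \<open>N\<close> that have more than one element have cardinality divisible by
  \<open>p\<close>, and so has \<open>N\<close>; hence \<open>p\<close> divides the number of elements of \<open>N\<close> that are central in \<open>G\<close>.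
  As \<open>\<one>\<close> is one of them, there is another, and a power of it has order \<open>p\<close>.
\<close>

lemma (in group) normal_meets_centre_of_p_group:
  fixes p m :: nat
  assumes p: "Factorial_Ring.prime p" and ord: "order G = p ^ m"
    and N: "N \<lhd> G" and nontriv: "N \<noteq> {\<one>}"
  shows "\<exists>z\<in>N. z \<noteq> \<one> \<and> z [^] p = \<one> \<and> (\<forall>g\<in>carrier G. g \<otimes> z = z \<otimes> g)"
proof -
  interpret N: normal N G by fact
  define \<phi> where "\<phi> = (\<lambda>g. \<lambda>h\<in>carrier G. g \<otimes> h \<otimes> inv g)"
  interpret conj: group_action G "carrier G" \<phi>
    unfolding \<phi>_def by (rule action_by_conjugation)
  have fin: "finite (carrier G)"
    using ord p prime_gt_0_nat[OF p] order_gt_0_iff_finite by simp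
  then have finN: "finite N"
    using N.subset finite_subset by blast
  have oneN: "\<one> \<in> N" by (rule N.one_closed)
  \<comment> \<open>The central elements of \<open>G\<close> in \<open>N\<close>; the other conjugacy classes in \<open>N\<close> form \<open>C\<close>.\<close>
  define F where "F = {x \<in> N. \<forall>g\<in>carrier G. g \<otimes> x = x \<otimes> g}"
  have FN: "F \<subseteq> N" by (auto simp: F_def)
  have "card N dvd p ^ m"
    using lagrange[OF N.subgroup_axioms] ord by (metis dvd_triv_right)
  moreover have "card N \<noteq> 1"
    using nontriv oneN card_1_singletonE by blast
  ultimately have pN: "p dvd card N"
    by (rule prime_dvd_of_dvd_prime_power[OF p])
  define C where "C = {orbit G \<phi> x | x. x \<in> N - F}"
  have orbN: "orbit G \<phi> x \<subseteq> N - F" if x: "x \<in> N - F" for x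
  proof
    fix y assume "y \<in> orbit G \<phi> x"
    then obtain g where g: "g \<in> carrier G" and y: "y = g \<otimes> x \<otimes> inv g"
      using x N.subset by (auto simp: orbit_def \<phi>_def)
    have xG: "x \<in> carrier G" using x N.subset by auto
    have yN: "y \<in> N" using x g y N.inv_op_closed2 by simp
    have "x \<in> F" if yF: "y \<in> F"
    proof -
      have yG: "y \<in> carrier G" using yN N.subset by blast
      have "g \<otimes> x = y \<otimes> g" using g xG by (simp add: y m_assoc)
      also have "\<dots> = g \<otimes> y" using yF g by (simp add: F_def)
      finally have "x = y" using g xG yG by simp
      then show ?thesis using yF by simp
    qed
    then show "y \<in> N - F" using yN x by auto
  qed
  have U: "\<Union>C = N - F"
  proof
    show "\<Union>C \<subseteq> N - F" using orbN by (auto simp: C_def)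
    show "N - F \<subseteq> \<Union>C"
    proof
      fix x assume x: "x \<in> N - F"
      then have "x \<in> orbit G \<phi> x" using conj.orbit_refl N.subset by blast
      then show "x \<in> \<Union>C" using x unfolding C_def by blast
    qed
  qed
  have "p dvd card (\<Union>C)"
  proof (rule dvd_partition)
    show "finite (\<Union>C)" using U finN by simp
    show "\<forall>c\<in>C. p dvd card c"
    proof
      fix c assume "c \<in> C"
      then obtain x where x: "x \<in> N - F" and c: "c = orbit G \<phi> x" by (auto simp: C_def)
      have xG: "x \<in> carrier G" using x N.subset by auto
      have "card c dvd p ^ m"
        using conj.orbit_stabilizer_theorem[OF xG] ord c by (metis dvd_triv_left)
      moreover have "card c \<noteq> 1"
      proof
        assume "card c = 1"
        then have c1: "c = {x}"
          using conj.orbit_refl[OF xG] c by (metis card_1_singletonE singletonD)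
        have "g \<otimes> x = x \<otimes> g" if g: "g \<in> carrier G" for g
        proof -
          have "g \<otimes> x \<otimes> inv g \<in> c"
            using g xG by (auto simp: c orbit_def \<phi>_def)
          then have "g \<otimes> x \<otimes> inv g = x" using c1 by simp
          then have "g \<otimes> x \<otimes> inv g \<otimes> g = x \<otimes> g" by simp
          then show ?thesis using g xG by (simp add: m_assoc)
        qed
        then show False using x by (auto simp: F_def)
      qed
      ultimately show "p dvd card c"
        by (rule prime_dvd_of_dvd_prime_power[OF p])
    qed
    show "\<forall>c1\<in>C. \<forall>c2\<in>C. c1 \<noteq> c2 \<longrightarrow> c1 \<inter> c2 = {}"
      using conj.disjoint_union N.subset unfolding C_def orbits_def by blast
  qed
  then have "p dvd card N - card F"
    using U FN finN by (simp add: card_Diff_subset finite_subset)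
  moreover have "card F \<le> card N" using FN finN by (rule card_mono[rotated])
  ultimately have "p dvd card F"
    using pN by (metis dvd_diffD1)
  moreover have oneF: "\<one> \<in> F" using oneN by (auto simp: F_def)
  moreover have "finite F" using FN finN finite_subset by blast
  ultimately have "F \<noteq> {\<one>}"
    using p prime_gt_1_nat[OF p] by auto
  then obtain x where x: "x \<in> F" "x \<noteq> \<one>" using oneF by blast
  have xN: "x \<in> N" using x FN by blast
  then have xG: "x \<in> carrier G" using N.subset by blast
  have "ord x dvd p ^ m"
    using ord_dvd_group_order[OF xG] ord by simp
  moreover have "ord x \<noteq> 1" using x xG ord_eq_1 by blast
  ultimately have po: "p dvd ord x"
    by (rule prime_dvd_of_dvd_prime_power[OF p])
  have o0: "ord x > 0" using ord_ge_1[OF fin xG] by simp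
  define z where "z = x [^] (ord x div p)"
  have k0: "ord x div p \<noteq> 0" using po o0 by (auto elim!: dvdE)
  have "ord z = ord x div (ord x div p)"
    unfolding z_def by (rule ord_pow) (use xG po k0 in \<open>auto elim: dvdE\<close>)
  then have oz: "ord z = p" using po o0 by (auto elim!: dvdE)
  have zG: "z \<in> carrier G" using xG by (simp add: z_def)
  have "z \<noteq> \<one>" using oz prime_gt_1_nat[OF p] by auto
  moreover have "z [^] p = \<one>" using pow_ord_eq_1[OF zG] oz by simp
  moreover have "x [^] n \<in> N" for n :: nat using xN by (induction n) auto
  then have "z \<in> N" by (simp add: z_def)
  moreover have "g \<otimes> z = z \<otimes> g" if g: "g \<in> carrier G" for g
    unfolding z_def by (rule group_commutes_pow[symmetric]) (use x g xG in \<open>auto simp: F_def\<close>)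
  ultimately show ?thesis by blast
qed

text \<open>
  This is the previous lemma for the image of \<open>K\<close> in \<open>G / A\<close>, expressed by representatives.
\<close>

lemma (in group) p_group_chief_step:
  fixes p m :: nat
  assumes p: "Factorial_Ring.prime p" and ord: "order G = p ^ m"
    and A: "A \<lhd> G" and K: "K \<lhd> G" and AK: "A \<subset> K"
  shows "\<exists>y\<in>K - A. y [^] p \<in> A \<and> (\<forall>g\<in>carrier G. g \<otimes> y \<otimes> inv g \<otimes> inv y \<in> A)"
proof -
  interpret A: normal A G by fact
  interpret K: normal K G by fact
  interpret Q: group "G Mod A" by (rule A.factorgroup_is_group)
  interpret q: group_hom G "G Mod A" "\<lambda>x. A #> x"
    by unfold_locales (rule A.r_coset_hom_Mod)
  have "order (G Mod A) * card A = p ^ m"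
    using lagrange[OF A.subgroup_axioms] ord by (simp add: order_def FactGroup_def)
  then obtain l where l: "order (G Mod A) = p ^ l"
    using p divides_primepow_nat by (metis dvd_triv_left)
  have "(\<lambda>x. A #> x) ` K \<lhd> G Mod A"
    by (rule K.surj_hom_normal_subgroup[OF q.group_hom_axioms]) (simp add: carrier_FactGroup)
  moreover have "(\<lambda>x. A #> x) ` K \<noteq> {\<one>\<^bsub>G Mod A\<^esub>}"
  proof
    assume *: "(\<lambda>x. A #> x) ` K = {\<one>\<^bsub>G Mod A\<^esub>}"
    have "x \<in> A" if "x \<in> K" for x
    proof -
      have "A #> x = A" using * that by auto
      then show ?thesis using that K.subset rcos_self[OF _ A.subgroup_axioms] by blast
    qed
    then show False using AK by blast
  qed
  ultimately obtain y where y: "y \<in> K" "A #> y \<noteq> A" "(A #> y) [^]\<^bsub>G Mod A\<^esub> p = A"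
    and comm: "\<And>g. g \<in> carrier G \<Longrightarrow> (A #> g) <#> (A #> y) = (A #> y) <#> (A #> g)"
    using Q.normal_meets_centre_of_p_group[OF p l, of "(\<lambda>x. A #> x) ` K"]
    by (auto simp: carrier_FactGroup)
  have yG: "y \<in> carrier G" using y K.subset by blast
  have "y \<notin> A" using y yG A.subgroup_axioms A.rcos_const by blast
  moreover have "y [^] p \<in> A"
    using y yG A.FactGroup_pow[OF yG, of p] rcos_self[OF _ A.subgroup_axioms, of "y [^] p"] by auto
  moreover have "g \<otimes> y \<otimes> inv g \<otimes> inv y \<in> A" if g: "g \<in> carrier G" for g
  proof -
    have "A #> (g \<otimes> y) = A #> (y \<otimes> g)"
      using comm[OF g] A.rcos_sum[OF g yG] A.rcos_sum[OF yG g] by metis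
    then have "g \<otimes> y \<in> A #> (y \<otimes> g)"
      using g yG rcos_self[OF _ A.subgroup_axioms, of "g \<otimes> y"] by simp
    then obtain a where a: "a \<in> A" "g \<otimes> y = a \<otimes> (y \<otimes> g)" by (auto simp: r_coset_def)
    then have "g \<otimes> y \<otimes> inv g \<otimes> inv y = a"
      using g yG A.subset by (auto simp: m_assoc inv_solve_right')
    then show ?thesis using a by simp
  qed
  ultimately show ?thesis using y(1) by (intro bexI[of _ y]) auto
qed

text \<open>
  The subgroup generated by \<open>S\<close> and \<open>y\<close>.  Since \<open>y [^] p\<close> lies in \<open>S\<close>, exponents can be reduced modulo \<open>p\<close>.
  The expression \<open>a \<otimes> y [^] n\<close> with \<open>n < p\<close> is unique, as a power of \<open>y\<close> with exponent prime to \<open>p\<close> that lies in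
  \<open>S\<close> would force \<open>y\<close> into \<open>S\<close>; this gives the order of \<open>T\<close>.
\<close>

lemma (in group) abelian_subgroup_adjoin_root:
  fixes p :: nat
  assumes p: "Factorial_Ring.prime p"
    and S: "subgroup S G" and ab: "\<And>a b. a \<in> S \<Longrightarrow> b \<in> S \<Longrightarrow> a \<otimes> b = b \<otimes> a"
    and y: "y \<in> carrier G" "y \<notin> S" "y [^] p \<in> S"
    and cy: "\<And>a. a \<in> S \<Longrightarrow> y \<otimes> a = a \<otimes> y"
    and T: "T = {a \<otimes> y [^] n | a n. a \<in> S \<and> n < p}"
  shows "subgroup T G" and "S \<subseteq> T" and "y \<in> T"
    and "\<And>a b. a \<in> T \<Longrightarrow> b \<in> T \<Longrightarrow> a \<otimes> b = b \<otimes> a"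
    and "card T = p * card S"
proof -
  interpret S: subgroup S G by fact
  have p0: "p > 0" "p > 1" using prime_gt_0_nat[OF p] prime_gt_1_nat[OF p] by auto
  have SG [simp]: "a \<in> carrier G" if "a \<in> S" for a using that S.subset by blast
  have cyn: "y [^] (n::nat) \<otimes> a = a \<otimes> y [^] n" if "a \<in> S" for a n
    by (rule group_commutes_pow) (use cy that y in auto)
  have powS: "(y [^] p) [^] (n::nat) \<in> S" for n using y by (induction n) auto
  have allT: "a \<otimes> y [^] (n::nat) \<in> T" if a: "a \<in> S" for a n
  proof -
    have "y [^] n = (y [^] p) [^] (n div p) \<otimes> y [^] (n mod p)"
      using y by (simp add: nat_pow_pow nat_pow_mult)
    then have "a \<otimes> y [^] n = (a \<otimes> (y [^] p) [^] (n div p)) \<otimes> y [^] (n mod p)"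
      using a y powS by (simp add: m_assoc)
    then show ?thesis
      unfolding T using S.m_closed[OF a powS] mod_less_divisor[OF p0(1)] by blast
  qed
  have mult: "(a \<otimes> y [^] (n::nat)) \<otimes> (b \<otimes> y [^] (k::nat)) = (a \<otimes> b) \<otimes> y [^] (n + k)"
    if "a \<in> S" "b \<in> S" for a b n k
  proof -
    have "(a \<otimes> y [^] n) \<otimes> (b \<otimes> y [^] k) = a \<otimes> (y [^] n \<otimes> b) \<otimes> y [^] k"
      using that y by (simp add: m_assoc)
    also have "\<dots> = (a \<otimes> b) \<otimes> (y [^] n \<otimes> y [^] k)"
      using that y by (simp add: cyn m_assoc)
    finally show ?thesis using y by (simp add: nat_pow_mult)
  qed
  show ST: "S \<subseteq> T"
  proof
    fix a assume "a \<in> S"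
    then show "a \<in> T" using allT[of a 0] by simp
  qed
  show "y \<in> T" using allT[of \<one> 1] y by simp
  show "subgroup T G"
  proof (rule subgroupI)
    show "T \<subseteq> carrier G" unfolding T using y by auto
    show "T \<noteq> {}" using ST S.one_closed by blast
  next
    fix t assume "t \<in> T"
    then obtain a n where t: "t = a \<otimes> y [^] n" "a \<in> S" "n < p" unfolding T by blast
    define b where "b = inv a \<otimes> inv ((y [^] p) [^] n)"
    have b: "b \<in> S" using t powS by (simp add: b_def)
    have "t \<otimes> (b \<otimes> y [^] ((p - 1) * n)) = (a \<otimes> b) \<otimes> y [^] (n + (p - 1) * n)"
      unfolding t by (rule mult) (use t b in auto)
    also have "n + (p - 1) * n = p * n" using p0 by (cases p) auto
    also have "y [^] (p * n) = (y [^] p) [^] n" using y by (simp add: nat_pow_pow)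
    also have "(a \<otimes> b) \<otimes> (y [^] p) [^] n = \<one>"
      using t y powS[of n] by (simp add: b_def m_assoc)
    finally have "inv t = b \<otimes> y [^] ((p - 1) * n)"
      using t b y by (intro inv_equality[OF inv_comm]) auto
    then show "inv t \<in> T" using allT[OF b] by simp
  next
    fix s t assume "s \<in> T" "t \<in> T"
    then obtain a b and n k :: nat where "s = a \<otimes> y [^] n" "a \<in> S" "t = b \<otimes> y [^] k" "b \<in> S"
      unfolding T by blast
    then show "s \<otimes> t \<in> T" using allT[of "a \<otimes> b" "n + k"] by (simp add: mult)
  qed
  show "s \<otimes> t = t \<otimes> s" if st: "s \<in> T" "t \<in> T" for s t
  proof -
    obtain a b and n k :: nat where "s = a \<otimes> y [^] n" "a \<in> S" "t = b \<otimes> y [^] k" "b \<in> S"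
      using st unfolding T by blast
    then show ?thesis using ab[of a b] by (simp add: mult add.commute)
  qed
  have nS: "y [^] (n::nat) \<notin> S" if n: "0 < n" "n < p" for n
  proof
    assume yn: "y [^] n \<in> S"
    \<comment> \<open>A Bezout relation between \<open>n\<close> and \<open>p\<close> exhibits \<open>y\<close> as an element of \<open>S\<close>.\<close>
    have "coprime n p"
      using p n by (metis coprime_commute nat_dvd_not_less prime_imp_coprime)
    then obtain u v where uv: "n * u = p * v + 1"
      using coprime_bezout_strong[of n p] p0 by auto
    have "(y [^] n) [^] u \<in> S" using yn by (induction u) auto
    then have "y [^] (p * v) \<otimes> y \<in> S"
      using y uv by (simp add: nat_pow_pow)
    moreover have "y [^] (p * v) \<in> S" using powS[of v] y by (simp add: nat_pow_pow)
    ultimately have "inv (y [^] (p * v)) \<otimes> (y [^] (p * v) \<otimes> y) \<in> S" by simp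
    then show False using y by (simp add: m_assoc[symmetric])
  qed
  have key: "n = k \<and> a = b"
    if "a \<in> S" "b \<in> S" "n \<le> k" "k < p" "a \<otimes> y [^] n = b \<otimes> y [^] k" for a b and n k :: nat
  proof -
    have "y [^] k = y [^] (k - n) \<otimes> y [^] n" using that y by (simp add: nat_pow_mult)
    then have "a \<otimes> y [^] n = (b \<otimes> y [^] (k - n)) \<otimes> y [^] n"
      using that y by (simp add: m_assoc)
    then have a: "a = b \<otimes> y [^] (k - n)" using that y by simp
    then have "y [^] (k - n) = inv b \<otimes> a" using that y by (simp add: m_assoc[symmetric])
    then have "y [^] (k - n) \<in> S" using that by simp
    then have "k - n = 0" using nS[of "k - n"] that by fastforce
    then show ?thesis using a that by simp
  qed
  have "inj_on (\<lambda>(a, n). a \<otimes> y [^] n) (S \<times> {..<p})"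
  proof (rule inj_onI, clarsimp)
    fix a n b k
    assume "a \<in> S" "n < p" "b \<in> S" "k < p" "a \<otimes> y [^] n = b \<otimes> y [^] k"
    then show "a = b \<and> n = k"
      using key[of a b n k] key[of b a k n] by (cases "n \<le> k") auto
  qed
  moreover have "T = (\<lambda>(a, n). a \<otimes> y [^] n) ` (S \<times> {..<p})"
    unfolding T by auto
  ultimately show "card T = p * card S"
    by (simp add: card_image card_cartesian_product)
qed

section \<open>Centralizers and counting\<close>

definition (in group) centralizer :: "'a set \<Rightarrow> 'a set"
  where "centralizer Y = {g \<in> carrier G. \<forall>x\<in>Y. g \<otimes> x = x \<otimes> g}"

lemma (in group) centralizer_subgroup:
  assumes Y: "Y \<subseteq> carrier G"
  shows "subgroup (centralizer Y) G"
proof (rule subgroupI)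
  show "centralizer Y \<subseteq> carrier G" by (auto simp: centralizer_def)
  show "centralizer Y \<noteq> {}" using Y by (auto simp: centralizer_def subset_iff intro!: exI[of _ \<one>])
next
  fix g assume g: "g \<in> centralizer Y"
  then have gG: "g \<in> carrier G" by (simp add: centralizer_def)
  have "inv g \<otimes> x = x \<otimes> inv g" if x: "x \<in> Y" for x
  proof -
    have xG: "x \<in> carrier G" using x Y by blast
    have "g \<otimes> (x \<otimes> inv g) = (g \<otimes> x) \<otimes> inv g" using gG xG by (simp add: m_assoc)
    also have "\<dots> = (x \<otimes> g) \<otimes> inv g" using g x by (simp add: centralizer_def)
    also have "\<dots> = x" using gG xG by (simp add: m_assoc)
    finally show ?thesis using gG xG by (simp add: inv_solve_left')
  qed
  then show "inv g \<in> centralizer Y" using gG by (simp add: centralizer_def)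
next
  fix g h assume gh: "g \<in> centralizer Y" "h \<in> centralizer Y"
  then have G: "g \<in> carrier G" "h \<in> carrier G" by (simp_all add: centralizer_def)
  have "g \<otimes> h \<otimes> x = x \<otimes> (g \<otimes> h)" if x: "x \<in> Y" for x
  proof -
    have xG: "x \<in> carrier G" using x Y by blast
    have "g \<otimes> h \<otimes> x = g \<otimes> (h \<otimes> x)" using G xG by (simp add: m_assoc)
    also have "h \<otimes> x = x \<otimes> h" using gh x by (simp add: centralizer_def)
    also have "g \<otimes> (x \<otimes> h) = (g \<otimes> x) \<otimes> h" using G xG by (simp add: m_assoc)
    also have "g \<otimes> x = x \<otimes> g" using gh x by (simp add: centralizer_def)
    finally show ?thesis using G xG by (simp add: m_assoc)
  qed
  then show "g \<otimes> h \<in> centralizer Y" using G by (simp add: centralizer_def)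
qed

lemma (in group) inv_mult_cancel:
  assumes "g \<in> carrier G" "x \<in> carrier G"
  shows "inv g \<otimes> (g \<otimes> x) = x" and "g \<otimes> (inv g \<otimes> x) = x"
  using assms by (simp_all flip: m_assoc)

lemma (in group) conjugate_pow:
  fixes n :: nat
  assumes "g \<in> carrier G" "x \<in> carrier G"
  shows "(g \<otimes> x \<otimes> inv g) [^] n = g \<otimes> x [^] n \<otimes> inv g"
proof (induction n)
  case (Suc n)
  have "(g \<otimes> x \<otimes> inv g) [^] Suc n = g \<otimes> x [^] n \<otimes> (inv g \<otimes> g) \<otimes> x \<otimes> inv g"
    using assms Suc by (simp add: m_assoc inv_mult_cancel)
  then show ?case using assms by (simp add: m_assoc)
qed (use assms in simp)

lemma card_le_mult_fibres:
  assumes "finite V" "f ` K \<subseteq> V" and fib: "\<And>v. v \<in> V \<Longrightarrow> card {u \<in> K. f u = v} \<le> n"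
  shows "card K \<le> n * card V"
proof -
  have "K = (\<Union>v\<in>V. {u \<in> K. f u = v})" using assms(2) by blast
  then have "card K \<le> (\<Sum>v\<in>V. card {u \<in> K. f u = v})"
    using card_UN_le[OF assms(1)] by metis
  also have "\<dots> \<le> of_nat (card V) * n" using fib by (rule sum_bounded_above)
  finally show ?thesis by (simp add: mult.commute)
qed

section \<open>Lifts to central extensions\<close>

locale central_extension = E: group E + G: group G for E (structure) and G +
  fixes \<pi>
  assumes hom: "\<pi> \<in> hom E G"
    and surj: "\<pi> ` carrier E = carrier G"
    and central: "\<And>z x. z \<in> carrier E \<Longrightarrow> \<pi> z = \<one>\<^bsub>G\<^esub> \<Longrightarrow> x \<in> carrier E \<Longrightarrow> z \<otimes> x = x \<otimes> z"
begin

sublocale \<pi>: group_hom E G \<pi>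
  by unfold_locales (rule hom)

text \<open>
  Such an \<open>S\<close> is the image of a homomorphic section of \<open>\<pi>\<close> over the normal subgroup \<open>\<pi> ` S\<close>.
\<close>

definition abelian_lift :: "'a set \<Rightarrow> bool"
  where "abelian_lift S \<longleftrightarrow>
    subgroup S E \<and> (\<forall>a\<in>S. \<forall>b\<in>S. a \<otimes> b = b \<otimes> a) \<and> inj_on \<pi> S \<and> \<pi> ` S \<lhd> G"

text \<open>
  Elements of \<open>E\<close> with the same image in \<open>G\<close> differ by a central element, so centralizers in
  \<open>E\<close> are unions of fibres of \<open>\<pi>\<close>.
\<close>

lemma centralizer_fibre:
  assumes "x \<in> E.centralizer Y" "y \<in> carrier E" "\<pi> y = \<pi> x" "Y \<subseteq> carrier E"
  shows "y \<in> E.centralizer Y"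
proof -
  have xE: "x \<in> carrier E" using assms by (simp add: E.centralizer_def)
  define z where "z = inv x \<otimes> y"
  have zE: "z \<in> carrier E" using xE assms by (simp add: z_def)
  have "\<pi> z = \<one>\<^bsub>G\<^esub>" using xE assms by (simp add: z_def)
  then have "z \<in> E.centralizer Y"
    using central zE assms(4) by (auto simp: E.centralizer_def)
  then have "x \<otimes> z \<in> E.centralizer Y"
    using assms E.centralizer_subgroup[OF assms(4)] by (simp add: subgroup.m_closed)
  then show ?thesis using xE assms by (simp add: z_def E.m_assoc[symmetric])
qed

lemma commutes_with_fibre:
  assumes "x \<in> E.centralizer S" "S \<subseteq> carrier E" "w \<in> carrier E" "\<pi> w \<in> \<pi> ` S"
  shows "w \<otimes> x = x \<otimes> w"
proof -
  obtain s where s: "s \<in> S" "\<pi> w = \<pi> s" using assms by blast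
  have x: "x \<in> carrier E" using assms by (simp add: E.centralizer_def)
  have "s \<in> E.centralizer {x}" using s assms by (auto simp: E.centralizer_def)
  then have "w \<in> E.centralizer {x}"
    using centralizer_fibre[of s "{x}" w] s x assms(3) by auto
  then show ?thesis by (simp add: E.centralizer_def)
qed

text \<open>
  A conjugate \<open>t\<close> of \<open>s \<in> S\<close> by an element of \<open>E\<close> may leave \<open>S\<close>, but its image stays in the normal subgroup
  \<open>\<pi> ` S\<close>.  So \<open>t\<close> is an element of \<open>S\<close> up to a central factor, and whatever centralizes \<open>S\<close> commutes with it.
\<close>

lemma image_centralizer_normal:
  assumes S: "abelian_lift S"
  shows "\<pi> ` E.centralizer S \<lhd> G"
proof -
  have SE: "S \<subseteq> carrier E" using S subgroup.subset unfolding abelian_lift_def by blast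
  interpret B: normal "\<pi> ` S" G using S by (simp add: abelian_lift_def)
  have "e \<otimes> x \<otimes> inv e \<in> E.centralizer S" if e: "e \<in> carrier E" and x: "x \<in> E.centralizer S" for e x
  proof -
    have xE: "x \<in> carrier E" using x by (simp add: E.centralizer_def)
    have "e \<otimes> x \<otimes> inv e \<otimes> s = s \<otimes> (e \<otimes> x \<otimes> inv e)" if s: "s \<in> S" for s
    proof -
      have sE: "s \<in> carrier E" using s SE by blast
      define t where "t = inv e \<otimes> s \<otimes> e"
      have tE: "t \<in> carrier E" using e sE by (simp add: t_def)
      have "\<pi> t = inv\<^bsub>G\<^esub> (\<pi> e) \<otimes>\<^bsub>G\<^esub> \<pi> s \<otimes>\<^bsub>G\<^esub> \<pi> e" using e sE by (simp add: t_def)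
      also have "\<dots> \<in> \<pi> ` S" using e s by (intro B.inv_op_closed1) auto
      finally have tx: "t \<otimes> x = x \<otimes> t" using commutes_with_fibre[OF x SE tE] by simp
      have se: "inv e \<otimes> s = t \<otimes> inv e" "s \<otimes> e = e \<otimes> t"
        using e sE by (simp_all add: t_def E.m_assoc E.inv_mult_cancel)
      have "e \<otimes> x \<otimes> inv e \<otimes> s = e \<otimes> (x \<otimes> t) \<otimes> inv e"
        using e sE xE tE by (simp add: E.m_assoc se(1))
      also have "\<dots> = (e \<otimes> t) \<otimes> x \<otimes> inv e"
        unfolding tx[symmetric] using e xE tE by (simp add: E.m_assoc)
      also have "\<dots> = s \<otimes> (e \<otimes> x \<otimes> inv e)"
        unfolding se(2)[symmetric] using e xE sE by (simp add: E.m_assoc)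
      finally show ?thesis .
    qed
    then show ?thesis using e xE by (simp add: E.centralizer_def)
  qed
  then have "E.centralizer S \<lhd> E"
    using E.normal_inv_iff E.centralizer_subgroup[OF SE] by blast
  then show ?thesis
    by (rule normal.surj_hom_normal_subgroup[OF _ \<pi>.group_hom_axioms surj])
qed

end

section \<open>Extending a lift by a factor \<open>p\<close>\<close>

text \<open>
  The two properties of \<open>\<complex>\<^sup>*\<close> that enter: \<open>p\<close>-th roots exist, which allows lifts to be
  extended, and there are at most \<open>p\<close> roots of unity of exponent \<open>p\<close>, which bounds the number of commutators.
\<close>

locale p_divisible_central_extension = central_extension +
  fixes p :: nat
  assumes prime_p: "Factorial_Ring.prime p"
    and finite_G: "finite (carrier G)"
    and p_roots: "\<And>z. z \<in> kernel E G \<pi> \<Longrightarrow> \<exists>w\<in>kernel E G \<pi>. w [^] p = z"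
    and finite_torsion: "finite {z \<in> kernel E G \<pi>. z [^] p = \<one>}"
    and card_torsion: "card {z \<in> kernel E G \<pi>. z [^] p = \<one>} \<le> p"
begin

text \<open>
  Two elements of \<open>V\<close> with the same image differ by a central element, whose \<open>p\<close>-th power is then
  trivial as well.  Thus every fibre of \<open>V\<close> over \<open>\<pi> ` S\<close> is empty or a translate of the \<open>p\<close>-torsion
  of the kernel.
\<close>

lemma card_torsion_over:
  assumes S: "abelian_lift S"
  defines "V \<equiv> {w \<in> carrier E. \<pi> w \<in> \<pi> ` S \<and> w [^] p = \<one>}"
  shows "finite V" and "card V \<le> p * card S"
proof -
  define M where "M = {z \<in> kernel E G \<pi>. z [^] p = \<one>}"
  have finS: "finite S"
  proof (rule finite_imageD)
    show "inj_on \<pi> S" using S by (simp add: abelian_lift_def)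
    show "finite (\<pi> ` S)"
      using S finite_G unfolding abelian_lift_def
      by (meson finite_subset normal_imp_subgroup subgroup.subset)
  qed
  \<comment> \<open>A base point in each fibre of \<open>V\<close> over \<open>\<pi> ` S\<close>, arbitrary where the fibre is empty.\<close>
  define r where "r = (\<lambda>s. SOME w. w \<in> V \<and> \<pi> w = \<pi> s)"
  have sub: "V \<subseteq> (\<lambda>(s, z). r s \<otimes> z) ` (S \<times> M)"
  proof
    fix w assume w: "w \<in> V"
    then obtain s where s: "s \<in> S" "\<pi> w = \<pi> s" unfolding V_def by blast
    then have "r s \<in> V \<and> \<pi> (r s) = \<pi> s"
      unfolding r_def using w by (intro someI[of "\<lambda>v. v \<in> V \<and> \<pi> v = \<pi> s" w]) simp
    then have r: "r s \<in> carrier E" "r s [^] p = \<one>" "\<pi> (r s) = \<pi> w"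
      using s by (auto simp: V_def)
    have wE: "w \<in> carrier E" "w [^] p = \<one>" using w by (auto simp: V_def)
    define z where "z = inv (r s) \<otimes> w"
    have zE: "z \<in> carrier E" using r wE by (simp add: z_def)
    have \<pi>z: "\<pi> z = \<one>\<^bsub>G\<^esub>" using r wE by (simp add: z_def)
    have rz: "r s \<otimes> z = w" using r wE by (simp add: z_def E.m_assoc[symmetric])
    have "w [^] p = r s [^] p \<otimes> z [^] p"
      unfolding rz[symmetric]
      by (rule E.pow_mult_distrib) (use central[OF zE \<pi>z] r zE in auto)
    then have "z [^] p = \<one>" using r wE zE by simp
    then have "z \<in> M" using zE \<pi>z by (simp add: M_def kernel_def)
    then show "w \<in> (\<lambda>(s, z). r s \<otimes> z) ` (S \<times> M)" using s(1) rz by force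
  qed
  have fin: "finite (S \<times> M)" using finS finite_torsion by (simp add: M_def)
  then show "finite V" using sub finite_surj by blast
  have "card V \<le> card (S \<times> M)" using fin sub by (rule surj_card_le)
  also have "\<dots> = card M * card S" by (simp add: card_cartesian_product)
  also have "\<dots> \<le> p * card S" using card_torsion by (simp add: M_def)
  finally show "card V \<le> p * card S" .
qed

text \<open>
  The map \<open>e \<mapsto> e y e\<inverse> y\<inverse>\<close> sends the centralizer of \<open>S\<close> to the set \<open>V\<close> of
  the previous lemma: the commutator \<open>w\<close> commutes with \<open>y\<close> because it lies over \<open>\<pi> ` S\<close>, so
  \<open>w ^ p y ^ p = (w y) ^ p = e y ^ p e\<inverse> = y ^ p\<close>.  Its fibres are cosets of the subgroup of
  elements that also commute with \<open>y\<close>.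
\<close>

lemma card_image_centralizer_le:
  assumes S: "abelian_lift S"
    and y: "y \<in> E.centralizer S" "y [^] p \<in> S"
    and cm: "\<And>e. e \<in> carrier E \<Longrightarrow> \<pi> (e \<otimes> y \<otimes> inv e \<otimes> inv y) \<in> \<pi> ` S"
  shows "card (\<pi> ` E.centralizer S)
    \<le> p * card S * card (\<pi> ` (E.centralizer S \<inter> E.centralizer {y}))"
proof -
  have SE: "S \<subseteq> carrier E" using S subgroup.subset unfolding abelian_lift_def by blast
  have yE: "y \<in> carrier E" using y by (simp add: E.centralizer_def)
  interpret C: subgroup "E.centralizer S" E by (rule E.centralizer_subgroup[OF SE])
  define V where "V = {w \<in> carrier E. \<pi> w \<in> \<pi> ` S \<and> w [^] p = \<one>}"
  define K where "K = \<pi> ` E.centralizer S"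
  define K' where "K' = \<pi> ` (E.centralizer S \<inter> E.centralizer {y})"
  have comm_V: "e \<otimes> y \<otimes> inv e \<otimes> inv y \<in> V" if e: "e \<in> E.centralizer S" for e
  proof -
    have eE: "e \<in> carrier E" using e by simp
    define w where "w = e \<otimes> y \<otimes> inv e \<otimes> inv y"
    have wE: "w \<in> carrier E" using eE yE by (simp add: w_def)
    have wS: "\<pi> w \<in> \<pi> ` S" using cm[OF eE] by (simp add: w_def)
    have wy: "w \<otimes> y = y \<otimes> w" by (rule commutes_with_fibre[OF y(1) SE wE wS])
    have "w [^] p \<otimes> y [^] p = (w \<otimes> y) [^] p"
      by (rule E.pow_mult_distrib[symmetric]) (use wy wE yE in auto)
    also have "w \<otimes> y = e \<otimes> y \<otimes> inv e" using eE yE by (simp add: w_def E.m_assoc)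
    also have "(e \<otimes> y \<otimes> inv e) [^] p = e \<otimes> y [^] p \<otimes> inv e"
      using eE yE by (rule E.conjugate_pow)
    also have "e \<otimes> y [^] p = y [^] p \<otimes> e"
      using e y(2) unfolding E.centralizer_def by blast
    also have "y [^] p \<otimes> e \<otimes> inv e = y [^] p" using eE yE by (simp add: E.m_assoc)
    finally have "w [^] p = \<one>" using wE yE by simp
    then show ?thesis using wE wS by (simp add: V_def w_def)
  qed
  \<comment> \<open>The counting takes place in the finite image \<open>K\<close>, by way of arbitrary lifts \<open>r u\<close>.\<close>
  obtain r where r: "\<And>u. u \<in> K \<Longrightarrow> r u \<in> E.centralizer S" "\<And>u. u \<in> K \<Longrightarrow> \<pi> (r u) = u"
  proof -
    have "\<forall>u\<in>K. \<exists>e. e \<in> E.centralizer S \<and> \<pi> e = u" by (auto simp: K_def)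
    from bchoice[OF this] show ?thesis using that by blast
  qed
  define f where "f = (\<lambda>u. r u \<otimes> y \<otimes> inv (r u) \<otimes> inv y)"
  have finK': "finite K'"
    using finite_G unfolding K'_def by (rule finite_subset[rotated]) auto
  have "card K \<le> card K' * card V"
  proof (rule card_le_mult_fibres)
    show "finite V" unfolding V_def by (rule card_torsion_over[OF S])
    show "f ` K \<subseteq> V" using comm_V r by (auto simp: f_def)
    fix v assume "v \<in> V"
    show "card {u \<in> K. f u = v} \<le> card K'"
    proof (cases "{u \<in> K. f u = v} = {}")
      case False
      then obtain u0 where u0: "u0 \<in> K" "f u0 = v" by blast
      have "{u \<in> K. f u = v} \<subseteq> (\<lambda>k. u0 \<otimes>\<^bsub>G\<^esub> k) ` K'"
      proof
        fix u assume "u \<in> {u \<in> K. f u = v}"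
        then have u: "u \<in> K" "f u = v" by auto
        define a where "a = r u"
        define b where "b = r u0"
        have ab: "a \<in> E.centralizer S" "b \<in> E.centralizer S"
          using r(1) u u0 by (simp_all add: a_def b_def)
        have abE: "a \<in> carrier E" "b \<in> carrier E" using ab by simp_all
        have "f u = f u0" using u u0 by simp
        then have eq: "a \<otimes> y \<otimes> inv a = b \<otimes> y \<otimes> inv b"
          using abE yE unfolding f_def a_def[symmetric] b_def[symmetric] by simp
        have "inv b \<otimes> a \<otimes> y = inv b \<otimes> (a \<otimes> y \<otimes> inv a) \<otimes> a"
          using abE yE by (simp add: E.m_assoc E.inv_mult_cancel)
        also have "\<dots> = y \<otimes> (inv b \<otimes> a)"
          unfolding eq using abE yE by (simp add: E.m_assoc E.inv_mult_cancel)
        finally have "inv b \<otimes> a \<in> E.centralizer {y}"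
          using abE unfolding E.centralizer_def by simp
        moreover have "inv b \<otimes> a \<in> E.centralizer S" using ab by simp
        ultimately have "\<pi> (inv b \<otimes> a) \<in> K'" unfolding K'_def by blast
        moreover have "u = u0 \<otimes>\<^bsub>G\<^esub> \<pi> (inv b \<otimes> a)"
        proof -
          have "u = \<pi> a" "u0 = \<pi> b" using r u u0 by (simp_all add: a_def b_def)
          then show ?thesis using abE by (simp add: G.inv_mult_cancel)
        qed
        ultimately show "u \<in> (\<lambda>k. u0 \<otimes>\<^bsub>G\<^esub> k) ` K'" by blast
      qed
      then show ?thesis using finK' by (rule surj_card_le[rotated])
    next
      case True
      then show ?thesis by (simp only: card.empty)
    qed
  qed
  also have "\<dots> \<le> card K' * (p * card S)"
    using card_torsion_over(2)[OF S] by (simp add: V_def)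
  finally show ?thesis by (simp add: K_def K'_def mult_ac)
qed

text \<open>
  The step of the construction, with the bound on what is lost in the centralizer.
\<close>

lemma abelian_lift_extend:
  assumes ord: "order G = p ^ m" and S: "abelian_lift S"
    and small: "card S < card (\<pi> ` E.centralizer S)"
  shows "\<exists>T. abelian_lift T \<and> card T = p * card S \<and>
    card (\<pi> ` E.centralizer S) \<le> p * card S * card (\<pi> ` E.centralizer T)"
proof -
  have S': "subgroup S E" "\<And>a b. a \<in> S \<Longrightarrow> b \<in> S \<Longrightarrow> a \<otimes> b = b \<otimes> a" "inj_on \<pi> S" "\<pi> ` S \<lhd> G"
    using S unfolding abelian_lift_def by blast+
  interpret S: subgroup S E by (rule S')
  interpret B: normal "\<pi> ` S" G by (rule S')
  have p0: "p > 0" by (rule prime_gt_0_nat[OF prime_p])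
  have SC: "S \<subseteq> E.centralizer S" using S'(2) S.subset by (auto simp: E.centralizer_def)
  have "\<pi> ` S \<noteq> \<pi> ` E.centralizer S" using small card_image[OF S'(3)] by (metis less_irrefl)
  then have "\<pi> ` S \<subset> \<pi> ` E.centralizer S" using SC by blast
  from G.p_group_chief_step[OF prime_p ord S'(4) image_centralizer_normal[OF S] this]
  obtain u where u: "u \<in> \<pi> ` E.centralizer S" "u \<notin> \<pi> ` S" "u [^]\<^bsub>G\<^esub> p \<in> \<pi> ` S"
    and cu: "\<And>g. g \<in> carrier G \<Longrightarrow> g \<otimes>\<^bsub>G\<^esub> u \<otimes>\<^bsub>G\<^esub> inv\<^bsub>G\<^esub> g \<otimes>\<^bsub>G\<^esub> inv\<^bsub>G\<^esub> u \<in> \<pi> ` S"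
    by blast
  obtain x where x: "x \<in> E.centralizer S" "\<pi> x = u" using u by blast
  have xE: "x \<in> carrier E" using x by (simp add: E.centralizer_def)
  have uG: "u \<in> carrier G" using x xE by auto
  obtain s where s: "s \<in> S" "\<pi> (x [^] p) = \<pi> s"
    using u(3) x xE by (auto simp: \<pi>.hom_nat_pow)
  have "inv s \<otimes> x [^] p \<in> kernel E G \<pi>"
    using s xE by (simp add: kernel_def)
  then obtain w where w: "w \<in> kernel E G \<pi>" "w [^] p = inv s \<otimes> x [^] p" using p_roots by blast
  have wE: "w \<in> carrier E" "\<pi> w = \<one>\<^bsub>G\<^esub>" using w by (auto simp: kernel_def)
  \<comment> \<open>The \<open>p\<close>-th power of \<open>x\<close> is \<open>s\<close> up to a central factor; dividing by a \<open>p\<close>-th root of that factor makes it equal to \<open>s\<close>.\<close>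
  define y where "y = x \<otimes> inv w"
  have yE: "y \<in> carrier E" using xE wE by (simp add: y_def)
  have \<pi>y: "\<pi> y = u" using x xE wE uG by (simp add: y_def)
  have yC: "y \<in> E.centralizer S"
    using centralizer_fibre[OF x(1) yE] \<pi>y x S.subset by simp
  have "y [^] p = x [^] p \<otimes> inv w [^] p"
    unfolding y_def
    by (rule E.pow_mult_distrib) (use central[of "inv w" x] xE wE in auto)
  also have "inv w [^] p = inv (inv s \<otimes> x [^] p)" using w wE by (simp add: E.nat_pow_inv)
  also have "x [^] p \<otimes> inv (inv s \<otimes> x [^] p) = s"
    using s xE by (simp add: E.inv_mult_group E.m_assoc[symmetric])
  finally have yp: "y [^] p \<in> S" using s by simp
  have yS: "y \<notin> S" using u(2) \<pi>y by blast
  have ys: "y \<otimes> a = a \<otimes> y" if "a \<in> S" for a using yC that by (simp add: E.centralizer_def)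
  define T where "T = {a \<otimes> y [^] n | a n. a \<in> S \<and> n < p}"
  note TE = E.abelian_subgroup_adjoin_root[OF prime_p S'(1,2) yE yS yp ys T_def]
  have \<pi>S: "\<And>a b. a \<in> \<pi> ` S \<Longrightarrow> b \<in> \<pi> ` S \<Longrightarrow> a \<otimes>\<^bsub>G\<^esub> b = b \<otimes>\<^bsub>G\<^esub> a"
  proof -
    fix a b assume "a \<in> \<pi> ` S" "b \<in> \<pi> ` S"
    then obtain a' b' where "a' \<in> S" "b' \<in> S" "a = \<pi> a'" "b = \<pi> b'" by blast
    then show "a \<otimes>\<^bsub>G\<^esub> b = b \<otimes>\<^bsub>G\<^esub> a" using S'(2)[of a' b'] by (simp flip: \<pi>.hom_mult)
  qed
  have \<pi>ys: "\<And>a. a \<in> \<pi> ` S \<Longrightarrow> u \<otimes>\<^bsub>G\<^esub> a = a \<otimes>\<^bsub>G\<^esub> u"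
    using ys yE by (auto simp flip: \<pi>.hom_mult \<pi>y)
  have \<pi>T: "\<pi> ` T = {a \<otimes>\<^bsub>G\<^esub> u [^]\<^bsub>G\<^esub> n | a n. a \<in> \<pi> ` S \<and> n < p}" (is "_ = ?R")
  proof
    show "\<pi> ` T \<subseteq> ?R"
    proof
      fix t assume "t \<in> \<pi> ` T"
      then obtain a n where "a \<in> S" "n < p" "t = \<pi> (a \<otimes> y [^] n)" unfolding T_def by blast
      moreover from this have "t = \<pi> a \<otimes>\<^bsub>G\<^esub> u [^]\<^bsub>G\<^esub> n" using yE by (simp add: \<pi>.hom_nat_pow \<pi>y)
      ultimately show "t \<in> ?R" by blast
    qed
    show "?R \<subseteq> \<pi> ` T"
    proof
      fix t assume "t \<in> ?R"
      then obtain a n where "a \<in> S" "n < p" "t = \<pi> a \<otimes>\<^bsub>G\<^esub> u [^]\<^bsub>G\<^esub> n" by blast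
      moreover from this have "t = \<pi> (a \<otimes> y [^] n)" using yE by (simp add: \<pi>.hom_nat_pow \<pi>y)
      ultimately show "t \<in> \<pi> ` T" unfolding T_def by blast
    qed
  qed
  note TG = G.abelian_subgroup_adjoin_root[OF prime_p B.subgroup_axioms \<pi>S uG u(2,3) \<pi>ys \<pi>T]
  have finT: "finite T"
  proof -
    have "finite (\<pi> ` S)" using finite_G B.subset finite_subset by blast
    then have "finite S" using S'(3) finite_imageD by blast
    moreover have "T = (\<lambda>(a, n). a \<otimes> y [^] n) ` (S \<times> {..<p})" by (auto simp: T_def)
    ultimately show ?thesis by simp
  qed
  \<comment> \<open>Adjoining \<open>y\<close> to \<open>S\<close> and \<open>u\<close> to \<open>\<pi> ` S\<close> multiplies both orders by \<open>p\<close>, so \<open>\<pi>\<close> stays injective.\<close>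
  have injT: "inj_on \<pi> T"
    using TE(5) TG(5) S'(3) by (intro eq_card_imp_inj_on[OF finT]) (simp add: card_image)
  interpret T: subgroup "\<pi> ` T" G by (rule TG(1))
  have "g \<otimes>\<^bsub>G\<^esub> t \<otimes>\<^bsub>G\<^esub> inv\<^bsub>G\<^esub> g \<in> \<pi> ` T" if g: "g \<in> carrier G" and t: "t \<in> \<pi> ` T" for g t
  proof -
    obtain a and n :: nat where an: "a \<in> \<pi> ` S" "t = a \<otimes>\<^bsub>G\<^esub> u [^]\<^bsub>G\<^esub> n" using t \<pi>T by blast
    have aG: "a \<in> carrier G" by (rule B.mem_carrier[OF an(1)])
    have 1: "g \<otimes>\<^bsub>G\<^esub> a \<otimes>\<^bsub>G\<^esub> inv\<^bsub>G\<^esub> g \<in> \<pi> ` T" using B.inv_op_closed2[OF g an(1)] TG(2) by blast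
    define c where "c = g \<otimes>\<^bsub>G\<^esub> u \<otimes>\<^bsub>G\<^esub> inv\<^bsub>G\<^esub> g \<otimes>\<^bsub>G\<^esub> inv\<^bsub>G\<^esub> u"
    have "c \<in> \<pi> ` T" using cu[OF g] TG(2) by (auto simp: c_def)
    then have "c \<otimes>\<^bsub>G\<^esub> u \<in> \<pi> ` T" using TG(3) by simp
    moreover have "c \<otimes>\<^bsub>G\<^esub> u = g \<otimes>\<^bsub>G\<^esub> u \<otimes>\<^bsub>G\<^esub> inv\<^bsub>G\<^esub> g" using g uG by (simp add: c_def G.m_assoc)
    ultimately have 2: "(g \<otimes>\<^bsub>G\<^esub> u \<otimes>\<^bsub>G\<^esub> inv\<^bsub>G\<^esub> g) [^]\<^bsub>G\<^esub> n \<in> \<pi> ` T"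
      by (induction n) auto
    have "g \<otimes>\<^bsub>G\<^esub> t \<otimes>\<^bsub>G\<^esub> inv\<^bsub>G\<^esub> g
        = (g \<otimes>\<^bsub>G\<^esub> a \<otimes>\<^bsub>G\<^esub> inv\<^bsub>G\<^esub> g) \<otimes>\<^bsub>G\<^esub> (g \<otimes>\<^bsub>G\<^esub> u \<otimes>\<^bsub>G\<^esub> inv\<^bsub>G\<^esub> g) [^]\<^bsub>G\<^esub> n"
      unfolding G.conjugate_pow[OF g uG] an(2) using g aG uG by (simp add: G.m_assoc G.inv_mult_cancel)
    then show ?thesis using T.m_closed[OF 1 2] by simp
  qed
  then have "\<pi> ` T \<lhd> G" using G.normal_inv_iff TG(1) by blast
  then have "abelian_lift T" using TE injT by (simp add: abelian_lift_def)
  moreover have "card (\<pi> ` E.centralizer S) \<le> p * card S * card (\<pi> ` E.centralizer T)"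
  proof -
    have "\<pi> (e \<otimes> y \<otimes> inv e \<otimes> inv y) \<in> \<pi> ` S" if "e \<in> carrier E" for e
      using cu[of "\<pi> e"] that yE by (simp add: \<pi>y)
    then have "card (\<pi> ` E.centralizer S)
        \<le> p * card S * card (\<pi> ` (E.centralizer S \<inter> E.centralizer {y}))"
      by (rule card_image_centralizer_le[OF S yC yp])
    also have "E.centralizer S \<inter> E.centralizer {y} \<subseteq> E.centralizer T"
    proof
      fix e assume e: "e \<in> E.centralizer S \<inter> E.centralizer {y}"
      then have eE: "e \<in> carrier E" and es: "\<And>s. s \<in> S \<Longrightarrow> e \<otimes> s = s \<otimes> e" and ey: "y \<otimes> e = e \<otimes> y"
        by (auto simp: E.centralizer_def)
      have "e \<otimes> (a \<otimes> y [^] n) = (a \<otimes> y [^] n) \<otimes> e" if a: "a \<in> S" for a and n :: nat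
      proof -
        have aE: "a \<in> carrier E" using a by simp
        have yn: "y [^] n \<otimes> e = e \<otimes> y [^] n" by (rule E.group_commutes_pow[OF ey yE eE])
        have "e \<otimes> (a \<otimes> y [^] n) = (e \<otimes> a) \<otimes> y [^] n" using eE aE yE by (simp add: E.m_assoc)
        also have "\<dots> = a \<otimes> (e \<otimes> y [^] n)" using eE aE yE es[OF a] by (simp add: E.m_assoc)
        also have "\<dots> = (a \<otimes> y [^] n) \<otimes> e" using eE aE yE by (simp add: E.m_assoc yn)
        finally show ?thesis .
      qed
      then show "e \<in> E.centralizer T" using eE by (auto simp: E.centralizer_def T_def)
    qed
    then have "card (\<pi> ` (E.centralizer S \<inter> E.centralizer {y})) \<le> card (\<pi> ` E.centralizer T)"
      by (intro card_mono image_mono finite_subset[OF _ finite_G]) (auto simp: E.centralizer_def)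
    finally show ?thesis by simp
  qed
  ultimately show ?thesis using TE(5) by blast
qed

text \<open>
  The exponent \<open>k (k + 1) / 2 = 1 + \<dots> + k\<close> adds up the losses \<open>p ^ j\<close> in the steps \<open>j = 1, \<dots>, k\<close>.
  The hypothesis for \<open>k + 1\<close> implies that the centralizer of a lift of order \<open>p ^ k\<close> still has an image
  of order at least \<open>p ^ (k + 1)\<close>, so that one more step is possible.
\<close>

lemma abelian_lift_exists:
  assumes ord: "order G = p ^ m"
  shows "k * (k + 1) \<le> 2 * m \<Longrightarrow> \<exists>S. abelian_lift S \<and> card S = p ^ k \<and>
    p ^ m \<le> p ^ (k * (k + 1) div 2) * card (\<pi> ` E.centralizer S)"
proof (induction k)
  case 0
  have "E.centralizer {\<one>} = carrier E" by (auto simp: E.centralizer_def)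
  moreover have "abelian_lift {\<one>}"
    unfolding abelian_lift_def using E.triv_subgroup G.one_is_normal by simp
  ultimately show ?case using ord surj by (intro exI[of _ "{\<one>}"]) (simp add: order_def)
next
  case (Suc k)
  have p1: "p > 1" by (rule prime_gt_1_nat[OF prime_p])
  have tri: "Suc k * (Suc k + 1) div 2 = k * (k + 1) div 2 + Suc k"
  proof -
    have "Suc k * (Suc k + 1) = k * (k + 1) + 2 * Suc k" by simp
    then show ?thesis by simp
  qed
  then have le: "k * (k + 1) div 2 + Suc k \<le> m" using Suc.prems by linarith
  have "k * (k + 1) \<le> 2 * m" using Suc.prems by simp
  then obtain S where S: "abelian_lift S" "card S = p ^ k"
    and K: "p ^ m \<le> p ^ (k * (k + 1) div 2) * card (\<pi> ` E.centralizer S)"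
    using Suc.IH by blast
  have "p ^ (k * (k + 1) div 2) * card S < p ^ (k * (k + 1) div 2) * p ^ Suc k"
    using p1 S by simp
  also have "\<dots> = p ^ (k * (k + 1) div 2 + Suc k)" by (simp only: power_add)
  also have "\<dots> \<le> p ^ m" using le p1 by (intro power_increasing) auto
  also note K
  finally have "card S < card (\<pi> ` E.centralizer S)" by simp
  from abelian_lift_extend[OF ord S(1) this] obtain T where
    T: "abelian_lift T" "card T = p * card S"
    and KT: "card (\<pi> ` E.centralizer S) \<le> p * card S * card (\<pi> ` E.centralizer T)" by blast
  have "p ^ m \<le> p ^ (k * (k + 1) div 2) * (p ^ Suc k * card (\<pi> ` E.centralizer T))"
    using K KT S(2) by (metis le_trans mult_le_mono2 power_Suc)
  also have "\<dots> = p ^ (Suc k * (Suc k + 1) div 2) * card (\<pi> ` E.centralizer T)"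
    unfolding tri by (simp add: power_add)
  finally show ?case using T S(2) by (intro exI[of _ T]) simp
qed

end

section \<open>The central extension of a cocycle\<close>

text \<open>
  Cochains are not normalised, so the neutral element carries the factor \<open>c (\<one>, \<one>)\<close> inverted;
  the same factor appears in the embedding of \<open>M\<close> below.
\<close>

definition cocycle_extension ::
  "('a, 'x) monoid_scheme \<Rightarrow> ('b, 'y) monoid_scheme \<Rightarrow> ('a \<times> 'a \<Rightarrow> 'b) \<Rightarrow> ('a \<times> 'b) monoid"
  where "cocycle_extension G M c =
    \<lparr>carrier = carrier G \<times> carrier M,
     monoid.mult = (\<lambda>(g, a) (h, b). (g \<otimes>\<^bsub>G\<^esub> h, a \<otimes>\<^bsub>M\<^esub> b \<otimes>\<^bsub>M\<^esub> c (g, h))),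
     one = (\<one>\<^bsub>G\<^esub>, inv\<^bsub>M\<^esub> c (\<one>\<^bsub>G\<^esub>, \<one>\<^bsub>G\<^esub>))\<rparr>"

locale cocycle = G: group G + M: comm_group M
  for G (structure) and M +
  fixes c
  assumes cocycle: "c \<in> cocycles2 G M"
begin

abbreviation Ext where "Ext \<equiv> cocycle_extension G M c"

lemma c_closed [simp]: "g \<in> carrier G \<Longrightarrow> h \<in> carrier G \<Longrightarrow> c (g, h) \<in> carrier M"
  using cocycle by (auto simp: cocycles2_def PiE_iff)

lemma cocycle_eq:
  "g \<in> carrier G \<Longrightarrow> h \<in> carrier G \<Longrightarrow> k \<in> carrier G \<Longrightarrow>
    c (h, k) \<otimes>\<^bsub>M\<^esub> c (g, h \<otimes> k) = c (g \<otimes> h, k) \<otimes>\<^bsub>M\<^esub> c (g, h)"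
  using cocycle by (auto simp: cocycles2_def)

lemma c_one_left: "g \<in> carrier G \<Longrightarrow> c (\<one>, g) = c (\<one>, \<one>)"
  using cocycle_eq[of \<one> \<one> g] by simp

lemma c_one_right: "g \<in> carrier G \<Longrightarrow> c (g, \<one>) = c (\<one>, \<one>)"
  using cocycle_eq[of g \<one> \<one>] by simp

lemma carrier_Ext: "carrier Ext = carrier G \<times> carrier M"
  and mult_Ext: "(g, a) \<otimes>\<^bsub>Ext\<^esub> (h, b) = (g \<otimes> h, a \<otimes>\<^bsub>M\<^esub> b \<otimes>\<^bsub>M\<^esub> c (g, h))"
  and one_Ext: "\<one>\<^bsub>Ext\<^esub> = (\<one>, inv\<^bsub>M\<^esub> c (\<one>, \<one>))"
  by (simp_all add: cocycle_extension_def)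

lemma group_Ext: "group Ext"
proof (rule groupI)
  show "\<one>\<^bsub>Ext\<^esub> \<in> carrier Ext" by (simp add: carrier_Ext one_Ext)
  show "x \<otimes>\<^bsub>Ext\<^esub> y \<in> carrier Ext" if "x \<in> carrier Ext" "y \<in> carrier Ext" for x y
    using that by (auto simp: carrier_Ext mult_Ext)
  show "\<one>\<^bsub>Ext\<^esub> \<otimes>\<^bsub>Ext\<^esub> x = x" if xE: "x \<in> carrier Ext" for x
  proof -
    obtain g a where x: "x = (g, a)" "g \<in> carrier G" "a \<in> carrier M"
      using xE by (auto simp: carrier_Ext)
    then show ?thesis by (simp add: mult_Ext one_Ext c_one_left[OF x(2)] M.m_ac)
  qed
next
  fix x y z assume "x \<in> carrier Ext" "y \<in> carrier Ext" "z \<in> carrier Ext"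
  then obtain g a h b k d where xyz: "x = (g, a)" "y = (h, b)" "z = (k, d)"
    and G [simp]: "g \<in> carrier G" "h \<in> carrier G" "k \<in> carrier G"
    and M [simp]: "a \<in> carrier M" "b \<in> carrier M" "d \<in> carrier M"
    by (auto simp: carrier_Ext)
  have "a \<otimes>\<^bsub>M\<^esub> b \<otimes>\<^bsub>M\<^esub> c (g, h) \<otimes>\<^bsub>M\<^esub> d \<otimes>\<^bsub>M\<^esub> c (g \<otimes> h, k)
      = a \<otimes>\<^bsub>M\<^esub> b \<otimes>\<^bsub>M\<^esub> d \<otimes>\<^bsub>M\<^esub> (c (g \<otimes> h, k) \<otimes>\<^bsub>M\<^esub> c (g, h))"
    by (simp add: M.m_ac)
  also have "\<dots> = a \<otimes>\<^bsub>M\<^esub> b \<otimes>\<^bsub>M\<^esub> d \<otimes>\<^bsub>M\<^esub> (c (h, k) \<otimes>\<^bsub>M\<^esub> c (g, h \<otimes> k))"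
    by (simp only: cocycle_eq[OF G])
  also have "\<dots> = a \<otimes>\<^bsub>M\<^esub> (b \<otimes>\<^bsub>M\<^esub> d \<otimes>\<^bsub>M\<^esub> c (h, k)) \<otimes>\<^bsub>M\<^esub> c (g, h \<otimes> k)"
    by (simp add: M.m_ac)
  finally show "x \<otimes>\<^bsub>Ext\<^esub> y \<otimes>\<^bsub>Ext\<^esub> z = x \<otimes>\<^bsub>Ext\<^esub> (y \<otimes>\<^bsub>Ext\<^esub> z)"
    by (simp add: xyz mult_Ext G.m_assoc)
next
  fix x assume "x \<in> carrier Ext"
  then obtain g a where x: "x = (g, a)" and [simp]: "g \<in> carrier G" "a \<in> carrier M"
    by (auto simp: carrier_Ext)
  define b where "b = inv\<^bsub>M\<^esub> c (\<one>, \<one>) \<otimes>\<^bsub>M\<^esub> inv\<^bsub>M\<^esub> (a \<otimes>\<^bsub>M\<^esub> c (inv g, g))"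
  have [simp]: "b \<in> carrier M" by (simp add: b_def)
  have "b \<otimes>\<^bsub>M\<^esub> a \<otimes>\<^bsub>M\<^esub> c (inv g, g) = b \<otimes>\<^bsub>M\<^esub> (a \<otimes>\<^bsub>M\<^esub> c (inv g, g))"
    by (simp add: M.m_assoc)
  also have "\<dots> = inv\<^bsub>M\<^esub> c (\<one>, \<one>)"
    unfolding b_def by (subst M.m_assoc) simp_all
  finally have "(inv g, b) \<otimes>\<^bsub>Ext\<^esub> x = \<one>\<^bsub>Ext\<^esub>"
    by (simp add: x mult_Ext one_Ext)
  then show "\<exists>y\<in>carrier Ext. y \<otimes>\<^bsub>Ext\<^esub> x = \<one>\<^bsub>Ext\<^esub>"
    by (intro bexI[of _ "(inv g, b)"]) (simp_all add: carrier_Ext)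
qed

lemma central_extension_Ext: "central_extension Ext G fst"
proof (intro central_extension.intro central_extension_axioms.intro group_Ext G.group_axioms)
  show "fst \<in> hom Ext G" by (auto simp: hom_def carrier_Ext mult_Ext)
  show "fst ` carrier Ext = carrier G" using M.one_closed by (auto simp: carrier_Ext fst_image_times)
  show "z \<otimes>\<^bsub>Ext\<^esub> x = x \<otimes>\<^bsub>Ext\<^esub> z"
    if zx: "z \<in> carrier Ext" "fst z = \<one>" "x \<in> carrier Ext" for z x
  proof -
    obtain g a b where x: "z = (\<one>, a)" "x = (g, b)" "g \<in> carrier G" "a \<in> carrier M" "b \<in> carrier M"
      using zx by (auto simp: carrier_Ext)
    then show ?thesis by (simp add: mult_Ext c_one_left[OF x(3)] c_one_right[OF x(3)] M.m_comm)
  qed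
qed

definition inclusion where "inclusion a = (\<one>, a \<otimes>\<^bsub>M\<^esub> inv\<^bsub>M\<^esub> c (\<one>, \<one>))"

lemma inclusion_hom: "inclusion \<in> hom M Ext"
proof (rule homI)
  fix a b assume [simp]: "a \<in> carrier M" "b \<in> carrier M"
  have "a \<otimes>\<^bsub>M\<^esub> inv\<^bsub>M\<^esub> c (\<one>, \<one>) \<otimes>\<^bsub>M\<^esub> (b \<otimes>\<^bsub>M\<^esub> inv\<^bsub>M\<^esub> c (\<one>, \<one>)) \<otimes>\<^bsub>M\<^esub> c (\<one>, \<one>)
      = a \<otimes>\<^bsub>M\<^esub> inv\<^bsub>M\<^esub> c (\<one>, \<one>) \<otimes>\<^bsub>M\<^esub> b"
    by (simp add: M.m_assoc)
  then show "inclusion (a \<otimes>\<^bsub>M\<^esub> b) = inclusion a \<otimes>\<^bsub>Ext\<^esub> inclusion b"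
    by (simp add: inclusion_def mult_Ext M.m_ac)
qed (simp add: inclusion_def carrier_Ext)

lemma kernel_fst: "kernel Ext G fst = inclusion ` carrier M"
proof
  show "kernel Ext G fst \<subseteq> inclusion ` carrier M"
  proof
    fix z assume "z \<in> kernel Ext G fst"
    then obtain a where a: "z = (\<one>, a)" "a \<in> carrier M" by (auto simp: kernel_def carrier_Ext)
    then have "z = inclusion (a \<otimes>\<^bsub>M\<^esub> c (\<one>, \<one>))" by (simp add: inclusion_def M.m_assoc)
    then show "z \<in> inclusion ` carrier M" by (rule image_eqI) (use a in simp)
  qed
qed (auto simp: inclusion_def kernel_def carrier_Ext)

lemma inclusion_pow: "a \<in> carrier M \<Longrightarrow> inclusion a [^]\<^bsub>Ext\<^esub> (n::nat) = inclusion (a [^]\<^bsub>M\<^esub> n)"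
  using hom_nat_pow[OF inclusion_hom _ M.group_axioms group_Ext] by simp

lemma inclusion_eq_one_iff: "a \<in> carrier M \<Longrightarrow> inclusion a = \<one>\<^bsub>Ext\<^esub> \<longleftrightarrow> a = \<one>\<^bsub>M\<^esub>"
  unfolding inclusion_def one_Ext
  by (metis M.inv_closed M.l_one M.one_closed M.r_cancel Pair_inject c_closed G.one_closed)

text \<open>
  An injective \<open>S\<close> is the graph of a function \<open>\<beta>\<close>, and closure under multiplication says
  \<open>\<beta> (g h) = \<beta> g \<beta> h c (g, h)\<close>.  Therefore \<open>c\<close> is the coboundary of the inverse of \<open>\<beta>\<close>.
\<close>

lemma restrict_coboundary_of_lift:
  assumes S: "subgroup S Ext" and inj: "inj_on fst S"
  shows "restrict c (fst ` S \<times> fst ` S) \<in> coboundaries2 (G\<lparr>carrier := fst ` S\<rparr>) M"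
proof -
  interpret S: subgroup S Ext by fact
  have "\<forall>g\<in>fst ` S. \<exists>a. (g, a) \<in> S" by force
  then obtain \<beta> where \<beta>: "\<And>g. g \<in> fst ` S \<Longrightarrow> (g, \<beta> g) \<in> S" by metis
  have \<beta>M [simp]: "g \<in> carrier G" "\<beta> g \<in> carrier M" if "g \<in> fst ` S" for g
    using S.mem_carrier[OF \<beta>[OF that]] by (simp_all add: carrier_Ext)
  have mult: "g \<otimes> h \<in> fst ` S" "\<beta> (g \<otimes> h) = \<beta> g \<otimes>\<^bsub>M\<^esub> \<beta> h \<otimes>\<^bsub>M\<^esub> c (g, h)"
    if "g \<in> fst ` S" "h \<in> fst ` S" for g h
  proof -
    have *: "(g \<otimes> h, \<beta> g \<otimes>\<^bsub>M\<^esub> \<beta> h \<otimes>\<^bsub>M\<^esub> c (g, h)) \<in> S"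
      using S.m_closed[OF \<beta>[OF that(1)] \<beta>[OF that(2)]] by (simp add: mult_Ext)
    then show gh: "g \<otimes> h \<in> fst ` S" by force
    show "\<beta> (g \<otimes> h) = \<beta> g \<otimes>\<^bsub>M\<^esub> \<beta> h \<otimes>\<^bsub>M\<^esub> c (g, h)"
      using inj_onD[OF inj _ \<beta>[OF gh] *] by simp
  qed
  define b where "b = (\<lambda>g\<in>fst ` S. inv\<^bsub>M\<^esub> \<beta> g)"
  have rearrange: "v \<otimes>\<^bsub>M\<^esub> (t \<otimes>\<^bsub>M\<^esub> s \<otimes>\<^bsub>M\<^esub> w) \<otimes>\<^bsub>M\<^esub> u = (v \<otimes>\<^bsub>M\<^esub> s) \<otimes>\<^bsub>M\<^esub> (u \<otimes>\<^bsub>M\<^esub> t) \<otimes>\<^bsub>M\<^esub> w"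
    if "s \<in> carrier M" "t \<in> carrier M" "u \<in> carrier M" "v \<in> carrier M" "w \<in> carrier M"
    for s t u v w
    using that by (simp add: M.m_ac)
  have "b h \<otimes>\<^bsub>M\<^esub> inv\<^bsub>M\<^esub> b (g \<otimes> h) \<otimes>\<^bsub>M\<^esub> b g = c (g, h)"
    if gh: "g \<in> fst ` S" "h \<in> fst ` S" for g h
  proof -
    have "b h \<otimes>\<^bsub>M\<^esub> inv\<^bsub>M\<^esub> b (g \<otimes> h) \<otimes>\<^bsub>M\<^esub> b g
        = inv\<^bsub>M\<^esub> \<beta> h \<otimes>\<^bsub>M\<^esub> (\<beta> g \<otimes>\<^bsub>M\<^esub> \<beta> h \<otimes>\<^bsub>M\<^esub> c (g, h)) \<otimes>\<^bsub>M\<^esub> inv\<^bsub>M\<^esub> \<beta> g"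
      using gh mult[OF gh] by (simp add: b_def)
    also have "\<dots> = (inv\<^bsub>M\<^esub> \<beta> h \<otimes>\<^bsub>M\<^esub> \<beta> h) \<otimes>\<^bsub>M\<^esub> (inv\<^bsub>M\<^esub> \<beta> g \<otimes>\<^bsub>M\<^esub> \<beta> g) \<otimes>\<^bsub>M\<^esub> c (g, h)"
      by (rule rearrange) (use gh in simp_all)
    also have "\<dots> = c (g, h)" using gh by simp
    finally show ?thesis .
  qed
  then have "restrict c (fst ` S \<times> fst ` S) = coboundary1 (G\<lparr>carrier := fst ` S\<rparr>) M b"
    by (auto simp: coboundary1_def fun_eq_iff restrict_def)
  moreover have "b \<in> carrier (cochains1 (G\<lparr>carrier := fst ` S\<rparr>) M)"
    by (auto simp: b_def)
  ultimately show ?thesis unfolding coboundaries2_def by blast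
qed

end

section \<open>Isotropic subgroups\<close>

lemma isotropic_if_restrict_coboundary:
  assumes G: "group G" and A: "subgroup A G" and c: "c \<in> cocycles2 G Cstar"
    and cob: "restrict c (A \<times> A) \<in> coboundaries2 (G\<lparr>carrier := A\<rparr>) Cstar"
  shows "isotropic G A (cohomology_class2 G Cstar c)"
proof -
  let ?A = "G\<lparr>carrier := A\<rparr>"
  have grA: "group ?A" by (rule subgroup.subgroup_is_group[OF A G])
  interpret Z: comm_group "cocycle2_group ?A Cstar"
    by (rule comm_group_cocycle2_group[OF grA comm_group_Cstar])
  have "cohomology_class2 ?A Cstar (restrict c (A \<times> A)) = coboundaries2 ?A Cstar"
    unfolding cohomology_class2_def
    by (rule subgroup.rcos_const[OF subgroup_coboundaries2[OF grA comm_group_Cstar] Z.group_axioms cob])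
  then show ?thesis
    unfolding isotropic_def res2_class[OF G comm_group_Cstar A c] using A by (simp add: H2_def)
qed

lemma Cstar_pow: "z [^]\<^bsub>Cstar\<^esub> (n::nat) = z ^ n"
  by (induction n) (simp_all add: Cstar_def nat_pow_def mult.commute)

lemma p_divisible_central_extension_Cstar:
  fixes p :: nat
  assumes p: "Factorial_Ring.prime p" and G: "group G" "finite (carrier G)"
    and c: "c \<in> cocycles2 G Cstar"
  shows "p_divisible_central_extension (cocycle_extension G Cstar c) G fst p"
proof -
  interpret cocycle G Cstar c
    by (intro cocycle.intro cocycle_axioms.intro G comm_group_Cstar c)
  have p0: "p > 0" by (rule prime_gt_0_nat[OF p])
  have Cs: "carrier Cstar = {z. z \<noteq> 0}" "\<one>\<^bsub>Cstar\<^esub> = 1" by (simp_all add: Cstar_def)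
  have tors: "{z \<in> kernel Ext G fst. z [^]\<^bsub>Ext\<^esub> p = \<one>\<^bsub>Ext\<^esub>} \<subseteq> inclusion ` {z. z ^ p = 1}"
  proof
    fix z assume z: "z \<in> {z \<in> kernel Ext G fst. z [^]\<^bsub>Ext\<^esub> p = \<one>\<^bsub>Ext\<^esub>}"
    then obtain a where a: "a \<in> carrier Cstar" "z = inclusion a" by (auto simp: kernel_fst)
    have "a [^]\<^bsub>Cstar\<^esub> p = \<one>\<^bsub>Cstar\<^esub>"
      using z a inclusion_eq_one_iff[of "a [^]\<^bsub>Cstar\<^esub> p"] by (simp add: inclusion_pow)
    then show "z \<in> inclusion ` {z. z ^ p = 1}" using a by (simp add: Cstar_pow Cs)
  qed
  have fin: "finite {z::complex. z ^ p = 1}" using p0 by (rule finite_nth_roots)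
  show ?thesis
  proof (intro p_divisible_central_extension.intro p_divisible_central_extension_axioms.intro
      central_extension_Ext p G(2))
    show "finite {z \<in> kernel Ext G fst. z [^]\<^bsub>Ext\<^esub> p = \<one>\<^bsub>Ext\<^esub>}"
      using tors fin finite_surj by blast
    have "card {z \<in> kernel Ext G fst. z [^]\<^bsub>Ext\<^esub> p = \<one>\<^bsub>Ext\<^esub>} \<le> card {z::complex. z ^ p = 1}"
      using fin tors by (rule surj_card_le)
    then show "card {z \<in> kernel Ext G fst. z [^]\<^bsub>Ext\<^esub> p = \<one>\<^bsub>Ext\<^esub>} \<le> p"
      using card_roots_unity_eq[OF p0] by simp
  next
    fix z assume "z \<in> kernel Ext G fst"
    then obtain a where a: "a \<in> carrier Cstar" "z = inclusion a" by (auto simp: kernel_fst)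
    have "card {w. w ^ p = a} = p" using a p0 by (intro card_nth_roots) (auto simp: Cs)
    then have "{w. w ^ p = a} \<noteq> {}" using p0 by (metis card.empty less_irrefl)
    then obtain w where w: "w ^ p = a" by blast
    then have wC: "w \<in> carrier Cstar" using a p0 by (auto simp: Cs)
    then have "inclusion w [^]\<^bsub>Ext\<^esub> p = z" using a w by (simp add: inclusion_pow Cstar_pow)
    then show "\<exists>w\<in>kernel Ext G fst. w [^]\<^bsub>Ext\<^esub> p = z" using wC by (auto simp: kernel_fst)
  qed
qed

theorem proposition3p2:
  fixes G :: "('a, 'b) monoid_scheme"
    and p m i :: nat
    and \<kappa> :: "('a \<times> 'a \<Rightarrow> complex) set"
  assumes "Factorial_Ring.prime p"
    and "group G"
    and "order G = p ^ m"
    and "\<kappa> \<in> carrier (H2 G Cstar)"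
    and "((real i)\<^sup>2 + real i - 2) / 2 < real m"
  shows "\<exists>A. A \<lhd> G \<and> comm_group (G\<lparr>carrier := A\<rparr>) \<and> card A = p ^ i \<and> isotropic G A \<kappa>"
proof -
  interpret G: group G by fact
  have finG: "finite (carrier G)"
    using assms(3) prime_gt_0_nat[OF assms(1)] G.order_gt_0_iff_finite by simp
  obtain c where c: "c \<in> cocycles2 G Cstar" and \<kappa>: "\<kappa> = cohomology_class2 G Cstar c"
    using assms(4) carrier_H2 by blast
  interpret cocycle G Cstar c
    by (intro cocycle.intro cocycle_axioms.intro comm_group_Cstar c) fact
  interpret ext: p_divisible_central_extension "cocycle_extension G Cstar c" G fst p
    by (rule p_divisible_central_extension_Cstar) fact+
  \<comment> \<open>The hypothesis reads \<open>i (i + 1) < 2 m + 2\<close>, and both sides are even.\<close>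
  have "real (i * (i + 1)) < real (2 * m + 2)"
    using assms(5) by (simp add: power2_eq_square field_simps)
  then have "i * (i + 1) < 2 * m + 2" by (simp only: of_nat_less_iff)
  moreover have "even (i * (i + 1))" by simp
  ultimately have "i * (i + 1) \<le> 2 * m" by presburger
  then obtain S where S: "ext.abelian_lift S" "card S = p ^ i"
    using ext.abelian_lift_exists[OF assms(3)] by blast
  have S': "subgroup S Ext" "\<And>a b. a \<in> S \<Longrightarrow> b \<in> S \<Longrightarrow> a \<otimes>\<^bsub>Ext\<^esub> b = b \<otimes>\<^bsub>Ext\<^esub> a"
    "inj_on fst S" "fst ` S \<lhd> G"
    using S(1) unfolding ext.abelian_lift_def by blast+
  have sub: "subgroup (fst ` S) G" by (rule normal_imp_subgroup[OF S'(4)])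
  have "comm_group (G\<lparr>carrier := fst ` S\<rparr>)"
  proof (rule group.group_comm_groupI)
    show "group (G\<lparr>carrier := fst ` S\<rparr>)" by (rule G.subgroup_imp_group[OF sub])
    fix a b assume "a \<in> carrier (G\<lparr>carrier := fst ` S\<rparr>)" "b \<in> carrier (G\<lparr>carrier := fst ` S\<rparr>)"
    then obtain x y where xy: "x \<in> S" "y \<in> S" "a = fst x" "b = fst y" by auto
    then have "x \<in> carrier Ext" "y \<in> carrier Ext" using subgroup.mem_carrier[OF S'(1)] by auto
    then show "a \<otimes>\<^bsub>G\<lparr>carrier := fst ` S\<rparr>\<^esub> b = b \<otimes>\<^bsub>G\<lparr>carrier := fst ` S\<rparr>\<^esub> a"
      using S'(2)[OF xy(1,2)] xy by (simp flip: ext.\<pi>.hom_mult)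
  qed
  moreover have "card (fst ` S) = p ^ i" using S S'(3) by (simp add: card_image)
  moreover have "isotropic G (fst ` S) \<kappa>"
    unfolding \<kappa> using assms(2) sub c restrict_coboundary_of_lift[OF S'(1,3)]
    by (rule isotropic_if_restrict_coboundary)
  ultimately show ?thesis using S'(4) by blast
qed

end
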